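(* Let $k$ be a fixed constant. The ILP consistency problem for $\mathcal{G}^*_k$ is decidable in polynomial time.
   Context: Clauses are finite disjunctions of first-order literals, treated as sets of literals. A signed relation name is a relation name together with the polarity of a literal in which it occurs. A clause is straight if no signed relation name occurs in it twice. $\phi \vdash \psi$ ($\theta$-subsumption) means there is a variable substitution $\theta$ with $\phi\theta\subseteq\psi$. A clause $C$ is $k$-guarded if there is a set $S\subseteq C$ of at most $k$ literals such that every variable of $C$ occurs in some literal of $S$. The ILP consistency problem for $\mathcal{G}^*_k$: given a finite set $E^+$ of straight ground clauses and a finite set $E^-$ of ground clauses, decide whether there exists a function-free $k$-guarded clause $H$ with $H \vdash C$ for all $C\in E^+$, $H\not\vdash C$ for all $C \in E^-$, and $\{H\}$ consistent. *)

theory Defs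
  imports Main "HOL-Computational_Algebra.Polynomial"
begin

section \<open>First-order clauses\<close>

text \<open>Names are words over a two-letter alphabet, so that the size of an instance accounts for the
  length of the names in it. A function symbol is a name together with the number of its arguments
  (a constant is a symbol with no arguments), and likewise for relation symbols; every symbol
  therefore has a fixed arity, and there are infinitely many symbols of each arity.\<close>

type_synonym name = "bool list"

datatype trm = Var name | Fun name "trm list"

datatype literal = Lit (positive: bool) (relation: name) (arguments: "trm list")

text \<open>Clauses are the finite sets of literals; finiteness is stated where a clause is not given as
  the set of elements of a list.\<close>

type_synonym clause = "literal set"

definition signed_relation :: "literal \<Rightarrow> bool \<times> name \<times> nat" where
  "signed_relation L = (positive L, relation L, length (arguments L))"

definition straight :: "clause \<Rightarrow> bool" where
  "straight C \<longleftrightarrow> inj_on signed_relation C"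

fun vars_trm :: "trm \<Rightarrow> name set" where
  "vars_trm (Var x) = {x}"
| "vars_trm (Fun f ts) = (\<Union>t\<in>set ts. vars_trm t)"

definition vars_literal :: "literal \<Rightarrow> name set" where
  "vars_literal L = (\<Union>t\<in>set (arguments L). vars_trm t)"

definition vars_clause :: "clause \<Rightarrow> name set" where
  "vars_clause C = (\<Union>L\<in>C. vars_literal L)"

definition ground :: "clause \<Rightarrow> bool" where
  "ground C \<longleftrightarrow> vars_clause C = {}"

fun subst_trm :: "(name \<Rightarrow> trm) \<Rightarrow> trm \<Rightarrow> trm" where
  "subst_trm \<theta> (Var x) = \<theta> x"
| "subst_trm \<theta> (Fun f ts) = Fun f (map (subst_trm \<theta>) ts)"

definition subst_literal :: "(name \<Rightarrow> trm) \<Rightarrow> literal \<Rightarrow> literal" where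
  "subst_literal \<theta> L = Lit (positive L) (relation L) (map (subst_trm \<theta>) (arguments L))"

definition subsumes :: "clause \<Rightarrow> clause \<Rightarrow> bool" (infix "\<turnstile>" 50) where
  "\<phi> \<turnstile> \<psi> \<longleftrightarrow> (\<exists>\<theta>. subst_literal \<theta> ` \<phi> \<subseteq> \<psi>)"

definition guarded :: "nat \<Rightarrow> clause \<Rightarrow> bool" where
  "guarded k C \<longleftrightarrow> (\<exists>S\<subseteq>C. finite S \<and> card S \<le> k \<and> vars_clause C \<subseteq> vars_clause S)"

text \<open>As usual for clauses, function-free excludes function symbols of positive arity only;
  constants are allowed.\<close>

fun function_free_trm :: "trm \<Rightarrow> bool" where
  "function_free_trm (Var x) \<longleftrightarrow> True"
| "function_free_trm (Fun f ts) \<longleftrightarrow> ts = []"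

definition function_free :: "clause \<Rightarrow> bool" where
  "function_free C \<longleftrightarrow> (\<forall>L\<in>C. \<forall>t\<in>set (arguments L). function_free_trm t)"


section \<open>Consistency\<close>

fun eval_trm :: "(name \<Rightarrow> 'u list \<Rightarrow> 'u) \<Rightarrow> (name \<Rightarrow> 'u) \<Rightarrow> trm \<Rightarrow> 'u" where
  "eval_trm F \<nu> (Var x) = \<nu> x"
| "eval_trm F \<nu> (Fun f ts) = F f (map (eval_trm F \<nu>) ts)"

definition true_literal ::
  "(name \<Rightarrow> 'u list \<Rightarrow> 'u) \<Rightarrow> (name \<Rightarrow> 'u list \<Rightarrow> bool) \<Rightarrow> (name \<Rightarrow> 'u) \<Rightarrow> literal \<Rightarrow> bool" where
  "true_literal F R \<nu> L \<longleftrightarrow>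
     (R (relation L) (map (eval_trm F \<nu>) (arguments L)) \<longleftrightarrow> positive L)"

definition is_structure :: "'u set \<Rightarrow> (name \<Rightarrow> 'u list \<Rightarrow> 'u) \<Rightarrow> bool" where
  "is_structure U F \<longleftrightarrow> U \<noteq> {} \<and> (\<forall>f. \<forall>us\<in>lists U. F f us \<in> U)"

text \<open>The variables of a clause are implicitly universally quantified.\<close>

definition true_clause ::
  "'u set \<Rightarrow> (name \<Rightarrow> 'u list \<Rightarrow> 'u) \<Rightarrow> (name \<Rightarrow> 'u list \<Rightarrow> bool) \<Rightarrow> clause \<Rightarrow> bool" where
  "true_clause U F R C \<longleftrightarrow> (\<forall>\<nu>. range \<nu> \<subseteq> U \<longrightarrow> (\<exists>L\<in>C. true_literal F R \<nu> L))"

text \<open>HOL cannot quantify over all universes. By the downward Loewenheim-Skolem theorem the nonempty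
  countable ones, represented by the nonempty sets of natural numbers, suffice.\<close>

definition consistent :: "clause set \<Rightarrow> bool" where
  "consistent T \<longleftrightarrow> (\<exists>(U :: nat set) F R. is_structure U F \<and> (\<forall>C\<in>T. true_clause U F R C))"


section \<open>Polynomial time\<close>

text \<open>The model of computation is the WHILE language of N. D. Jones (Computability and Complexity
  from a Programming Perspective, 1997): imperative programs whose variables hold binary trees. Every
  program uses only finitely many variables. The size of a tree is its number of inner nodes. A test
  inspects the root only and takes one step, while an assignment is charged for the size of the tree
  that it stores, so that sharing of subtrees gives no advantage. With these costs every tree stored
  during a run of time \<open>t\<close> on an input of size \<open>n\<close> has size at most \<open>n + t\<close>. Hence
  Turing machines simulate programs with polynomial overhead, and vice versa, and the problems
  decidable in polynomial time are those of the class P.\<close>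

datatype tree = Leaf | Node tree tree

datatype expr = Get nat | Empty | Join expr expr | Left expr | Right expr

datatype com =
    Skip
  | Assign nat expr
  | Seq com com
  | Cond expr com com
  | While expr com

type_synonym state = "nat \<Rightarrow> tree"

fun left :: "tree \<Rightarrow> tree" where
  "left Leaf = Leaf"
| "left (Node a b) = a"

fun right :: "tree \<Rightarrow> tree" where
  "right Leaf = Leaf"
| "right (Node a b) = b"

fun eval_expr :: "expr \<Rightarrow> state \<Rightarrow> tree" where
  "eval_expr (Get x) s = s x"
| "eval_expr Empty s = Leaf"
| "eval_expr (Join e f) s = Node (eval_expr e s) (eval_expr f s)"
| "eval_expr (Left e) s = left (eval_expr e s)"
| "eval_expr (Right e) s = right (eval_expr e s)"

text \<open>\<open>exec c s t s'\<close>: started in state \<open>s\<close>, the program \<open>c\<close> halts after time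
  \<open>t\<close> in state \<open>s'\<close>. A tree different from \<open>Leaf\<close> counts as true.\<close>

inductive exec :: "com \<Rightarrow> state \<Rightarrow> nat \<Rightarrow> state \<Rightarrow> bool" where
  Skip: "exec Skip s 1 s"
| Assign: "exec (Assign x e) s (1 + size (eval_expr e s)) (s(x := eval_expr e s))"
| Seq: "exec c s t s' \<Longrightarrow> exec d s' t' s'' \<Longrightarrow> exec (Seq c d) s (t + t') s''"
| CondTrue: "eval_expr e s \<noteq> Leaf \<Longrightarrow> exec c s t s' \<Longrightarrow> exec (Cond e c d) s (1 + t) s'"
| CondFalse: "eval_expr e s = Leaf \<Longrightarrow> exec d s t s' \<Longrightarrow> exec (Cond e c d) s (1 + t) s'"
| WhileTrue: "eval_expr e s \<noteq> Leaf \<Longrightarrow> exec c s t s' \<Longrightarrow> exec (While e c) s' t' s'' \<Longrightarrow>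
    exec (While e c) s (1 + t + t') s''"
| WhileFalse: "eval_expr e s = Leaf \<Longrightarrow> exec (While e c) s 1 s"

inductive_cases exec_SkipE: "exec Skip s t s'"
inductive_cases exec_AssignE: "exec (Assign x e) s t s'"
inductive_cases exec_SeqE: "exec (Seq c d) s t s'"
inductive_cases exec_CondE: "exec (Cond e c d) s t s'"
inductive_cases exec_WhileE: "exec (While e c) s t s'"

lemma exec_deterministic:
  "exec c s t s' \<Longrightarrow> exec c s u s'' \<Longrightarrow> u = t \<and> s'' = s'"
proof (induction arbitrary: u s'' rule: exec.induct)
  case (Skip s)
  then show ?case by (rule exec_SkipE) simp
next
  case (Assign x e s)
  then show ?case by (rule exec_AssignE) simp
next
  case (Seq c s t s' d t' s2)
  from Seq.prems show ?case
  proof (rule exec_SeqE)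
    fix t1 r t2 assume "u = t1 + t2" "exec c s t1 r" "exec d r t2 s''"
    with Seq.IH show ?thesis by (metis plus_1_eq_Suc add_Suc)
  qed
next
  case (CondTrue e s c t s' d)
  from CondTrue.prems show ?case
  proof (rule exec_CondE)
    fix t1 assume "u = Suc t1" "exec c s t1 s''"
    with CondTrue.IH show ?thesis by (metis plus_1_eq_Suc add_Suc)
  next
    assume "eval_expr e s = Leaf"
    with CondTrue.hyps show ?thesis by simp
  qed
next
  case (CondFalse e s d t s' c)
  from CondFalse.prems show ?case
  proof (rule exec_CondE)
    fix t1 assume "u = Suc t1" "exec d s t1 s''"
    with CondFalse.IH show ?thesis by (metis plus_1_eq_Suc add_Suc)
  next
    assume "eval_expr e s \<noteq> Leaf"
    with CondFalse.hyps show ?thesis by simp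
  qed
next
  case (WhileTrue e s c t s' t' s2)
  from WhileTrue.prems show ?case
  proof (rule exec_WhileE)
    fix t1 r t2 assume "u = Suc (t1 + t2)" "exec c s t1 r" "exec (While e c) r t2 s''"
    with WhileTrue.IH show ?thesis by (metis plus_1_eq_Suc add_Suc)
  next
    assume "eval_expr e s = Leaf"
    with WhileTrue.hyps show ?thesis by simp
  qed
next
  case (WhileFalse e s c)
  from WhileFalse.prems show ?case by (rule exec_WhileE) (use WhileFalse in auto)
qed

definition initial_state :: "tree \<Rightarrow> state" where
  "initial_state a = (\<lambda>x. Leaf)(0 := a)"

text \<open>A decision problem is given by its set of instances, an encoding of the instances as trees and
  the property to be decided. A single program and a single polynomial serve all instances.\<close>

definition decidable_in_polynomial_time ::
  "'i set \<Rightarrow> ('i \<Rightarrow> tree) \<Rightarrow> ('i \<Rightarrow> bool) \<Rightarrow> bool" where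
  "decidable_in_polynomial_time I enc P \<longleftrightarrow>
     (\<exists>(c :: com) (p :: nat poly). \<forall>i\<in>I. \<exists>t s.
        exec c (initial_state (enc i)) t s \<and> t \<le> poly p (size (enc i)) \<and>
        (s 0 \<noteq> Leaf \<longleftrightarrow> P i))"


section \<open>The ILP consistency problem\<close>

text \<open>An instance consists of the positive and the negative examples. The finite sets of clauses are
  presented as lists of lists of literals, in any order and possibly with repetitions.\<close>

type_synonym instance_lists = "literal list list \<times> literal list list"

definition clauses :: "literal list list \<Rightarrow> clause set" where
  "clauses Cs = set ` set Cs"

definition ilp_instances :: "instance_lists set" where
  "ilp_instances = {(Ps, Ns).
     (\<forall>C\<in>clauses Ps. straight C \<and> ground C) \<and> (\<forall>C\<in>clauses Ns. ground C)}"

definition ilp_consistent :: "nat \<Rightarrow> clause set \<Rightarrow> clause set \<Rightarrow> bool" where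
  "ilp_consistent k Epos Eneg \<longleftrightarrow>
     (\<exists>H. finite H \<and> function_free H \<and> guarded k H \<and>
        (\<forall>C\<in>Epos. H \<turnstile> C) \<and> (\<forall>C\<in>Eneg. \<not> H \<turnstile> C) \<and> consistent {H})"

fun enc_list :: "tree list \<Rightarrow> tree" where
  "enc_list [] = Leaf"
| "enc_list (a # as) = Node a (enc_list as)"

definition enc_bool :: "bool \<Rightarrow> tree" where
  "enc_bool b = (if b then Node Leaf Leaf else Leaf)"

definition enc_name :: "name \<Rightarrow> tree" where
  "enc_name n = enc_list (map enc_bool n)"

fun enc_trm :: "trm \<Rightarrow> tree" where
  "enc_trm (Var x) = Node (enc_bool False) (enc_name x)"
| "enc_trm (Fun f ts) = Node (enc_bool True) (Node (enc_name f) (enc_list (map enc_trm ts)))"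

definition enc_literal :: "literal \<Rightarrow> tree" where
  "enc_literal L = Node (enc_bool (positive L))
     (Node (enc_name (relation L)) (enc_list (map enc_trm (arguments L))))"

definition enc_clauses :: "literal list list \<Rightarrow> tree" where
  "enc_clauses Cs = enc_list (map (\<lambda>C. enc_list (map enc_literal C)) Cs)"

definition enc_instance :: "instance_lists \<Rightarrow> tree" where
  "enc_instance = (\<lambda>(Ps, Ns). Node (enc_clauses Ps) (enc_clauses Ns))"

lemma inj_enc_list: "inj enc_list"
proof (rule injI)
  fix as bs show "enc_list as = enc_list bs \<Longrightarrow> as = bs"
  proof (induction as arbitrary: bs)
    case Nil then show ?case by (cases bs) auto
  next
    case (Cons a as) then show ?case by (cases bs) auto
  qed
qed

lemma inj_enc_name: "inj enc_name"
proof -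
  have "inj enc_bool"
    by (rule injI) (simp add: enc_bool_def split: if_splits)
  then show ?thesis
    by (intro injI) (simp add: enc_name_def inj_eq[OF inj_enc_list] inj_map_eq_map)
qed

lemma inj_enc_trm: "inj enc_trm"
proof (rule injI)
  fix t u show "enc_trm t = enc_trm u \<Longrightarrow> t = u"
  proof (induction t arbitrary: u)
    case (Var x) then show ?case
      by (cases u) (auto simp: enc_bool_def inj_eq[OF inj_enc_name])
  next
    case (Fun f ts)
    obtain g us where u: "u = Fun g us"
      using Fun.prems by (cases u) (auto simp: enc_bool_def)
    have "f = g" "map enc_trm ts = map enc_trm us"
      using Fun.prems u by (auto simp: inj_eq[OF inj_enc_name] inj_eq[OF inj_enc_list])
    moreover have "ts = us" if "map enc_trm ts = map enc_trm us"
      using Fun.IH that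
    proof (induction ts arbitrary: us)
      case Nil then show ?case by simp
    next
      case (Cons a ts)
      obtain b vs where us: "us = b # vs" using Cons.prems(2) by (cases us) simp_all
      have "a = b" using Cons.prems us by simp
      moreover have "ts = vs" using Cons.prems us by (intro Cons.IH) simp_all
      ultimately show ?case using us by simp
    qed
    ultimately show ?case using u by simp
  qed
qed

lemma inj_enc_literal: "inj enc_literal"
proof (rule injI)
  fix L M assume "enc_literal L = enc_literal M"
  then show "L = M"
    by (cases L; cases M) (simp add: enc_literal_def enc_bool_def inj_eq[OF inj_enc_name]
        inj_eq[OF inj_enc_list] inj_map_eq_map[OF inj_enc_trm] split: if_splits)
qed

lemma inj_enc_clauses: "inj enc_clauses"
proof -
  have "inj (\<lambda>C. enc_list (map enc_literal C))"
    by (rule injI) (simp add: inj_eq[OF inj_enc_list] inj_map_eq_map[OF inj_enc_literal])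
  then show ?thesis
    by (intro injI) (simp add: enc_clauses_def inj_eq[OF inj_enc_list] inj_map_eq_map)
qed

lemma inj_enc_instance: "inj enc_instance"
  by (rule injI) (auto simp: enc_instance_def inj_eq[OF inj_enc_clauses])

end

theory Submission imports Defs begin

text \<open>The least general function-free clause \<open>G\<close> that subsumes all positive examples has one literal
  for every signed relation name common to all of them, because they are straight, and hence
  polynomial size. A hypothesis \<open>H\<close> subsuming the positive examples has an instance contained in
  \<open>G\<close>, and this instance is again \<open>k\<close>-guarded, nonempty, and subsumes no more clauses than
  \<open>H\<close>. As larger clauses subsume fewer clauses, it suffices to consider, for each choice \<open>S\<close> of
  \<open>k\<close> literals of \<open>G\<close>, the set of all literals of \<open>G\<close> whose variables occur in \<open>S\<close>. Whether
  such a clause subsumes a negative example is decided by trying all images of the literals in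
  \<open>S\<close>, since they determine the substitution. A clause is consistent iff it is nonempty. Without
  positive examples, a single literal with a fresh relation name is a solution.\<close>

section \<open>A calculus of polynomial-time functions\<close>

text \<open>Programs only see trees, so every type in the calculus carries an injective code. The
  instances below agree with the codes of the problem statement, so that \<open>enc_instance\<close>
  becomes \<open>encode\<close>. Injectivity reduces equality of values to equality of
  trees.\<close>

class encodable =
  fixes encode :: "'a \<Rightarrow> tree"
  assumes inj_encode: "inj encode"

lemma encode_eq_iff [simp]: "encode x = encode y \<longleftrightarrow> x = y"
  using inj_encode by (rule inj_eq)

instantiation tree :: encodable
begin
definition encode_tree :: "tree \<Rightarrow> tree" where [simp]: "encode_tree a = a"
instance by standard (simp add: inj_def)
end

instantiation bool :: encodable
begin
definition [simp]: "encode = enc_bool"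
instance by standard (simp add: inj_def enc_bool_def split: if_splits)
end

instantiation list :: (encodable) encodable
begin
definition encode_list_def: "encode xs = enc_list (map encode xs)"
instance by standard (simp add: inj_def encode_list_def inj_eq[OF inj_enc_list] inj_map_eq_map[OF inj_encode])
end

instantiation prod :: (encodable, encodable) encodable
begin
definition encode_prod_def: "encode p = Node (encode (fst p)) (encode (snd p))"
instance by standard (auto simp: inj_def encode_prod_def prod_eq_iff)
end

instantiation trm :: encodable
begin
definition [simp]: "encode = enc_trm"
instance by standard (simp add: inj_enc_trm)
end

instantiation literal :: encodable
begin
definition [simp]: "encode = enc_literal"
instance by standard (simp add: inj_enc_literal)
end

lemma encode_Nil [simp]: "encode [] = Leaf"
  and encode_Cons [simp]: "encode (x # xs) = Node (encode x) (encode xs)"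
  by (simp_all add: encode_list_def)

lemma encode_Pair [simp]: "encode (x, y) = Node (encode x) (encode y)"
  by (simp add: encode_prod_def)

lemma enc_name_eq: "enc_name = encode"
  by (simp add: fun_eq_iff enc_name_def encode_list_def)

lemma enc_instance_eq: "enc_instance = encode"
proof -
  have "(\<lambda>C. enc_list (map enc_literal C)) = encode"
    by (simp add: fun_eq_iff encode_list_def)
  then have "enc_instance i = encode i" for i
    by (cases i) (simp add: enc_instance_def enc_clauses_def encode_list_def)
  then show ?thesis by (rule ext)
qed

abbreviation encode_size :: "'a::encodable \<Rightarrow> nat" where
  "encode_size x \<equiv> size (encode x)"

lemma encode_size_append: "encode_size (xs @ ys) = encode_size xs + encode_size ys"
  by (induction xs) auto

lemma encode_size_bool: "encode_size (b :: bool) \<le> 1"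
  by (cases b) (simp_all add: enc_bool_def)

lemma length_le_encode_size: "length xs \<le> encode_size xs"
  by (induction xs) auto

lemma encode_size_mem: "x \<in> set xs \<Longrightarrow> encode_size x \<le> encode_size xs"
  by (induction xs) auto

subsection \<open>Polynomially bounded functions\<close>

definition poly_bounded :: "('a::encodable \<Rightarrow> nat) \<Rightarrow> bool" where
  "poly_bounded g \<longleftrightarrow> (\<exists>p. \<forall>x. g x \<le> poly p (encode_size x))"

text \<open>The coefficients are natural numbers. Monotonicity allows size bounds to be substituted
  into time bounds.\<close>

lemma poly_nat_mono: "a \<le> b \<Longrightarrow> poly p a \<le> poly p b" for p :: "nat poly"
  by (induction p) (auto intro!: add_mono mult_mono)

lemma poly_boundedI: "(\<And>x. g x \<le> poly p (encode_size x)) \<Longrightarrow> poly_bounded g"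
  by (auto simp: poly_bounded_def)

lemma poly_boundedE:
  assumes "poly_bounded g"
  obtains p where "\<And>x. g x \<le> poly p (encode_size x)"
  using assms unfolding poly_bounded_def by metis

lemma poly_bounded_mono: "poly_bounded h \<Longrightarrow> (\<And>x. g x \<le> h x) \<Longrightarrow> poly_bounded g"
  unfolding poly_bounded_def by (meson le_trans)

lemma poly_bounded_const: "poly_bounded (\<lambda>x. n)"
  by (rule poly_boundedI[where p = "[:n:]"]) simp

lemma poly_bounded_encode_size: "poly_bounded encode_size"
  by (rule poly_boundedI[where p = "[:0, 1:]"]) simp

lemma poly_bounded_add: "poly_bounded g \<Longrightarrow> poly_bounded h \<Longrightarrow> poly_bounded (\<lambda>x. g x + h x)"
  unfolding poly_bounded_def by (metis add_mono poly_add)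

lemma poly_bounded_mult: "poly_bounded g \<Longrightarrow> poly_bounded h \<Longrightarrow> poly_bounded (\<lambda>x. g x * h x)"
  unfolding poly_bounded_def by (metis mult_le_mono poly_mult)

lemma poly_bounded_poly: "poly_bounded g \<Longrightarrow> poly_bounded (\<lambda>x. poly p (g x))"
  unfolding poly_bounded_def by (metis poly_pcompose poly_nat_mono)

lemma poly_bounded_comp:
  "poly_bounded g \<Longrightarrow> poly_bounded (\<lambda>x. encode_size (f x)) \<Longrightarrow> poly_bounded (\<lambda>x. g (f x))"
  unfolding poly_bounded_def[of g] using poly_bounded_poly poly_bounded_mono by metis

lemmas poly_bounded_intros = poly_bounded_const poly_bounded_encode_size poly_bounded_add
  poly_bounded_mult poly_bounded_poly

subsection \<open>Programs for functions\<close>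

text \<open>The time is bounded by \<open>b\<close> instead of being given exactly, so that both
  branches of a conditional can share one bound. The variables below \<open>n\<close> form a frame
  that keeps its contents.\<close>

definition runs :: "com \<Rightarrow> nat \<Rightarrow> state \<Rightarrow> nat \<Rightarrow> state \<Rightarrow> bool" where
  "runs c n s b s' \<longleftrightarrow> (\<exists>t\<le>b. exec c s t s') \<and> (\<forall>i<n. s' i = s i)"

lemma runs_Assign:
  "n \<le> m \<Longrightarrow> runs (Assign m e) n s (1 + size (eval_expr e s)) (s(m := eval_expr e s))"
  using exec.Assign[of m e s] by (auto simp: runs_def)

lemma runs_Seq:
  assumes "runs c m s b s'" "runs d n s' b' s''" "l \<le> m" "l \<le> n"
  shows "runs (Seq c d) l s (b + b') s''"
  using assms unfolding runs_def by (metis add_mono exec.Seq less_le_trans)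

lemma runs_Cond:
  assumes "eval_expr e s \<noteq> Leaf \<Longrightarrow> runs c n s b s'" "eval_expr e s = Leaf \<Longrightarrow> runs d n s b s'"
  shows "runs (Cond e c d) n s (1 + b) s'"
  using assms unfolding runs_def
  by (cases "eval_expr e s = Leaf") (metis add_left_mono exec.CondFalse, metis add_left_mono exec.CondTrue)

lemma runs_WhileTrue:
  assumes "eval_expr e s \<noteq> Leaf" "runs c n s b s'" "runs (While e c) n s' b' s''"
  shows "runs (While e c) n s (1 + b + b') s''"
  using assms unfolding runs_def by (metis add_left_mono add_mono exec.WhileTrue)

lemma runs_WhileFalse: "eval_expr e s = Leaf \<Longrightarrow> runs (While e c) n s 1 s"
  using exec.WhileFalse unfolding runs_def by blast

lemma runs_mono: "runs c n s b s' \<Longrightarrow> b \<le> b' \<Longrightarrow> runs c n s b' s'"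
  unfolding runs_def by (meson le_trans)

text \<open>For every \<open>n\<close> there must be a program that replaces the contents of variable \<open>n\<close>
  and uses only variables above \<open>n\<close> as scratch space. This makes the notion compositional
  without any renaming or cleaning of variables.\<close>

definition poly_time :: "('a::encodable \<Rightarrow> 'b::encodable) \<Rightarrow> bool" where
  "poly_time f \<longleftrightarrow> (\<exists>b c. poly_bounded b \<and>
     (\<forall>n s x. s n = encode x \<longrightarrow> (\<exists>s'. runs (c n) n s (b x) s' \<and> s' n = encode (f x))))"

lemma poly_timeI:
  assumes "poly_bounded b"
    "\<And>n s x. s n = encode x \<Longrightarrow> \<exists>s'. runs (c n) n s (b x) s' \<and> s' n = encode (f x)"
  shows "poly_time f"
  using assms unfolding poly_time_def by blast

lemma poly_timeE:
  assumes "poly_time f"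
  obtains b c where "poly_bounded b"
    "\<And>n s x. s n = encode x \<Longrightarrow> \<exists>s'. runs (c n) n s (b x) s' \<and> s' n = encode (f x)"
  using assms unfolding poly_time_def by blast

text \<open>An assignment costs more than the size of the tree that it stores, so the final content
  of a variable is either its old one or paid for by \<open>t\<close>.\<close>

lemma exec_size: "exec c s t s' \<Longrightarrow> size (s' x) \<le> size (s x) + t"
  by (induction rule: exec.induct) auto

text \<open>By \<open>exec_size\<close> the output is no larger than the input size plus the running
  time. Composition needs this, because the second program is charged in terms of the intermediate
  value.\<close>

lemma poly_bounded_encode_size_poly_time:
  assumes "poly_time f"
  shows "poly_bounded (\<lambda>x. encode_size (f x))"
proof -
  obtain b c where b: "poly_bounded b"
    and c: "\<And>n s x. s n = encode x \<Longrightarrow> \<exists>s'. runs (c n) n s (b x) s' \<and> s' n = encode (f x)"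
    using assms by (rule poly_timeE) blast
  have "encode_size (f x) \<le> encode_size x + b x" for x
  proof -
    obtain t s' where "exec (c 0) (\<lambda>_. encode x) t s'" "t \<le> b x" "s' 0 = encode (f x)"
      using c[of "\<lambda>_. encode x" 0 x] by (auto simp: runs_def)
    then show ?thesis
      using exec_size[of "c 0" "\<lambda>_. encode x" t s' 0] by simp
  qed
  then show ?thesis
    by (rule poly_bounded_mono[rotated]) (intro poly_bounded_intros b)
qed

section \<open>Closure under composition, constructors and case distinctions\<close>

lemma poly_time_comp:
  assumes g: "poly_time g" and f: "poly_time f"
  shows "poly_time (\<lambda>x. g (f x))"
proof -
  obtain b c where b: "poly_bounded b"
    and c: "\<And>n s x. s n = encode x \<Longrightarrow> \<exists>s'. runs (c n) n s (b x) s' \<and> s' n = encode (f x)"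
    using f by (rule poly_timeE) blast
  obtain b' d where b': "poly_bounded b'"
    and d: "\<And>n s x. s n = encode x \<Longrightarrow> \<exists>s'. runs (d n) n s (b' x) s' \<and> s' n = encode (g x)"
    using g by (rule poly_timeE) blast
  show ?thesis
  proof (rule poly_timeI[where b = "\<lambda>x. b x + b' (f x)" and c = "\<lambda>n. Seq (c n) (d n)"])
    show "poly_bounded (\<lambda>x. b x + b' (f x))"
      by (intro poly_bounded_add b poly_bounded_comp[OF b'] poly_bounded_encode_size_poly_time f)
    show "\<exists>s'. runs (Seq (c n) (d n)) n s (b x + b' (f x)) s' \<and> s' n = encode (g (f x))"
      if "s n = encode x" for n s x
      using c[of s n x, OF that] d[of _ n "f x"] runs_Seq by blast
  qed
qed

lemma poly_time_expr:
  assumes "poly_bounded (\<lambda>x. encode_size (f x))"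
    "\<And>n s x. s n = encode x \<Longrightarrow> eval_expr (e n) s = encode (f x)"
  shows "poly_time f"
proof (rule poly_timeI[where b = "\<lambda>x. 1 + encode_size (f x)" and c = "\<lambda>n. Assign n (e n)"])
  show "\<exists>s'. runs (Assign n (e n)) n s (1 + encode_size (f x)) s' \<and> s' n = encode (f x)"
    if "s n = encode x" for n s x
    using runs_Assign[of n n "e n" s] assms(2)[of s n x, OF that] by auto
qed (intro poly_bounded_intros assms(1))

lemma poly_time_proj:
  assumes "\<And>x. encode_size (f x) \<le> encode_size x"
    "\<And>n s x. s n = encode x \<Longrightarrow> eval_expr (e n) s = encode (f x)"
  shows "poly_time f"
  by (rule poly_time_expr[OF poly_bounded_mono[OF poly_bounded_encode_size] assms(2)])
    (simp_all add: assms(1))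

lemma poly_time_id: "poly_time (\<lambda>x. x)"
  by (rule poly_time_proj[where e = Get]) simp_all

fun expr_of_tree :: "tree \<Rightarrow> expr" where
  "expr_of_tree Leaf = Empty"
| "expr_of_tree (Node a b) = Join (expr_of_tree a) (expr_of_tree b)"

lemma eval_expr_of_tree: "eval_expr (expr_of_tree a) s = a"
  by (induction a) simp_all

lemma poly_time_const: "poly_time (\<lambda>x. c)"
  by (rule poly_time_expr[where e = "\<lambda>n. expr_of_tree (encode c)"])
    (simp_all add: eval_expr_of_tree poly_bounded_const)

named_theorems poly_time_intros

declare poly_time_id [poly_time_intros] poly_time_const [poly_time_intros]

lemma poly_time_encode [THEN poly_time_comp, poly_time_intros]: "poly_time encode"
  by (rule poly_time_proj[where e = Get]) simp_all

lemma poly_time_fst [THEN poly_time_comp, poly_time_intros]: "poly_time fst"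
  by (rule poly_time_proj[where e = "\<lambda>n. Left (Get n)"]) (auto simp: encode_prod_def)

lemma poly_time_snd [THEN poly_time_comp, poly_time_intros]: "poly_time snd"
  by (rule poly_time_proj[where e = "\<lambda>n. Right (Get n)"]) (auto simp: encode_prod_def)

lemma poly_time_left [THEN poly_time_comp, poly_time_intros]: "poly_time left"
  by (rule poly_time_proj[where e = "\<lambda>n. Left (Get n)"]) (case_tac x; simp)+

lemma poly_time_right [THEN poly_time_comp, poly_time_intros]: "poly_time right"
  by (rule poly_time_proj[where e = "\<lambda>n. Right (Get n)"]) (case_tac x; simp)+

lemma poly_time_positive [THEN poly_time_comp, poly_time_intros]: "poly_time positive"
  by (rule poly_time_proj[where e = "\<lambda>n. Left (Get n)"]) (auto simp: enc_literal_def)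

lemma poly_time_relation [THEN poly_time_comp, poly_time_intros]: "poly_time relation"
  by (rule poly_time_proj[where e = "\<lambda>n. Left (Right (Get n))"])
    (auto simp: enc_literal_def enc_name_eq)

lemma poly_time_arguments [THEN poly_time_comp, poly_time_intros]: "poly_time arguments"
  by (rule poly_time_proj[where e = "\<lambda>n. Right (Right (Get n))"])
    (auto simp: enc_literal_def encode_list_def)

text \<open>Leaving the type of \<open>h\<close> open lets one lemma serve tree nodes, pairs and
  nonempty lists, whose codes are all nodes over two codes.\<close>

lemma poly_time_Node:
  assumes f: "poly_time f" and g: "poly_time g"
    and h: "\<And>x. encode (h x) = Node (encode (f x)) (encode (g x))"
  shows "poly_time h"
proof -
  obtain b c where b: "poly_bounded b"
    and c: "\<And>n s x. s n = encode x \<Longrightarrow> \<exists>s'. runs (c n) n s (b x) s' \<and> s' n = encode (f x)"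
    using f by (rule poly_timeE) blast
  obtain b' d where b': "poly_bounded b'"
    and d: "\<And>n s x. s n = encode x \<Longrightarrow> \<exists>s'. runs (d n) n s (b' x) s' \<and> s' n = encode (g x)"
    using g by (rule poly_timeE) blast
  let ?b = "\<lambda>x. (1 + encode_size x) + (b x + ((1 + encode_size x) + (b' x +
    (1 + (1 + encode_size (f x) + encode_size (g x))))))"
  \<comment> \<open>Each program overwrites its input and therefore works on a copy. The second copy
    is placed at \<open>n+2\<close> so that \<open>d (n+2)\<close> preserves the first result at
    \<open>n+1\<close>.\<close>
  let ?c = "\<lambda>n. Seq (Assign (n+1) (Get n)) (Seq (c (n+1)) (Seq (Assign (n+2) (Get n))
    (Seq (d (n+2)) (Assign n (Join (Get (n+1)) (Get (n+2)))))))"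
  show ?thesis
  proof (rule poly_timeI[where b = ?b and c = ?c])
    show "poly_bounded ?b"
      by (intro poly_bounded_intros b b' poly_bounded_encode_size_poly_time f g)
    show "\<exists>s'. runs (?c n) n s (?b x) s' \<and> s' n = encode (h x)" if s: "s n = encode x" for n s x
    proof -
      let ?s1 = "s(n+1 := encode x)"
      have r1: "runs (Assign (n+1) (Get n)) n s (1 + encode_size x) ?s1"
        using runs_Assign[of n "n+1" "Get n" s] s by simp
      obtain s2 where r2: "runs (c (n+1)) (n+1) ?s1 (b x) s2" and s2: "s2 (n+1) = encode (f x)"
        using c[of ?s1 "n+1" x] by auto
      have s2': "s2 n = encode x"
        using r2 s by (simp add: runs_def)
      let ?s3 = "s2(n+2 := encode x)"
      have r3: "runs (Assign (n+2) (Get n)) n s2 (1 + encode_size x) ?s3"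
        using runs_Assign[of n "n+2" "Get n" s2] s2' by simp
      obtain s4 where r4: "runs (d (n+2)) (n+2) ?s3 (b' x) s4" and s4: "s4 (n+2) = encode (g x)"
        using d[of ?s3 "n+2" x] by auto
      have s4': "s4 (n+1) = encode (f x)"
        using r4 s2 by (simp add: runs_def)
      let ?s5 = "s4(n := encode (h x))"
      have r5: "runs (Assign n (Join (Get (n+1)) (Get (n+2)))) n s4
          (1 + (1 + encode_size (f x) + encode_size (g x))) ?s5"
        using runs_Assign[of n n "Join (Get (n+1)) (Get (n+2))" s4] s4 s4' by (simp add: h)
      have "runs (?c n) n s (?b x) ?s5"
        by (rule runs_Seq[OF r1 runs_Seq[OF r2 runs_Seq[OF r3 runs_Seq[OF r4 r5, of n], of n], of n], of n]) simp_all
      then show ?thesis by (intro exI[of _ ?s5]) simp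
    qed
  qed
qed

lemma poly_time_tree_Node [poly_time_intros]:
  "poly_time f \<Longrightarrow> poly_time g \<Longrightarrow> poly_time (\<lambda>x. Node (f x) (g x))"
  by (rule poly_time_Node[of f g]) simp_all

lemma poly_time_Pair [poly_time_intros]:
  "poly_time f \<Longrightarrow> poly_time g \<Longrightarrow> poly_time (\<lambda>x. (f x, g x))"
  by (rule poly_time_Node[of f g]) simp_all

lemma poly_time_Cons [poly_time_intros]:
  "poly_time f \<Longrightarrow> poly_time g \<Longrightarrow> poly_time (\<lambda>x. f x # g x)"
  by (rule poly_time_Node[of f g]) simp_all

lemma poly_time_comp2:
  assumes "poly_time (\<lambda>p. h (fst p) (snd p))" "poly_time f" "poly_time g"
  shows "poly_time (\<lambda>x. h (f x) (g x))"
  using poly_time_comp[OF assms(1) poly_time_Pair[OF assms(2,3)]] by simp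

text \<open>The type of \<open>y\<close> differs from that of \<open>l x\<close>: the code of a nonempty list is also the
  code of the pair of its head and its tail.\<close>

lemma poly_time_branch:
  assumes l: "poly_time (l :: _ \<Rightarrow> 'c::encodable)"
    and f: "poly_time f"
    and g: "poly_time (g :: 'a::encodable \<times> 'd::encodable \<Rightarrow> _)"
    and h: "\<And>x. encode (l x) = Leaf \<Longrightarrow> h x = f x"
      "\<And>x. encode (l x) \<noteq> Leaf \<Longrightarrow> \<exists>y. encode y = encode (l x) \<and> h x = g (x, y)"
  shows "poly_time h"
proof -
  obtain b0 c0 where b0: "poly_bounded b0"
    and c0: "\<And>n s x. s n = encode x \<Longrightarrow> \<exists>s'. runs (c0 n) n s (b0 x) s' \<and> s' n = encode (l x)"
    using l by (rule poly_timeE) blast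
  obtain b c where b: "poly_bounded b"
    and c: "\<And>n s x. s n = encode x \<Longrightarrow> \<exists>s'. runs (c n) n s (b x) s' \<and> s' n = encode (f x)"
    using f by (rule poly_timeE) blast
  obtain b1 d where b1: "poly_bounded b1"
    and d: "\<And>n s x. s n = encode x \<Longrightarrow> \<exists>s'. runs (d n) n s (b1 x) s' \<and> s' n = encode (g x)"
    using g by (rule poly_timeE) blast
  \<comment> \<open>The argument \<open>y\<close> of \<open>g\<close> is known only through its
    code, so the time for \<open>g\<close> is bounded through the size of the code of
    \<open>(x, y)\<close>, which is \<open>?w x\<close>.\<close>
  obtain q where q: "\<And>x. b1 x \<le> poly q (encode_size x)"
    using b1 by (rule poly_boundedE) blast
  let ?w = "\<lambda>x. 1 + encode_size x + encode_size (l x)"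
  let ?b = "\<lambda>x. (1 + encode_size x) + (b0 x + (1 + (b x + ((1 + ?w x) + poly q (?w x)))))"
  let ?c = "\<lambda>n. Seq (Assign (n+1) (Get n)) (Seq (c0 (n+1)) (Cond (Get (n+1))
    (Seq (Assign n (Join (Get n) (Get (n+1)))) (d n)) (c n)))"
  show ?thesis
  proof (rule poly_timeI[where b = ?b and c = ?c])
    show "poly_bounded ?b"
      by (intro poly_bounded_intros b b0 poly_bounded_encode_size_poly_time l)
    show "\<exists>s'. runs (?c n) n s (?b x) s' \<and> s' n = encode (h x)" if s: "s n = encode x" for n s x
    proof -
      let ?s1 = "s(n+1 := encode x)"
      have r1: "runs (Assign (n+1) (Get n)) n s (1 + encode_size x) ?s1"
        using runs_Assign[of n "n+1" "Get n" s] s by simp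
      obtain s2 where r2: "runs (c0 (n+1)) (n+1) ?s1 (b0 x) s2" and s2: "s2 (n+1) = encode (l x)"
        using c0[of ?s1 "n+1" x] by auto
      have s2': "s2 n = encode x"
        using r2 s by (simp add: runs_def)
      obtain s4 where r4: "runs (Cond (Get (n+1))
          (Seq (Assign n (Join (Get n) (Get (n+1)))) (d n)) (c n)) n s2
          (1 + (b x + ((1 + ?w x) + poly q (?w x)))) s4" and s4: "s4 n = encode (h x)"
      proof (cases "encode (l x) = Leaf")
        case True
        obtain s4 where "runs (c n) n s2 (b x) s4" "s4 n = encode (f x)"
          using c[of s2 n x] s2' by auto
        moreover from this(1) have "runs (c n) n s2 (b x + ((1 + ?w x) + poly q (?w x))) s4"
          by (rule runs_mono) simp
        ultimately show ?thesis
          using True s2 h(1)[of x] by (intro that[of s4] runs_Cond) auto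
      next
        case False
        obtain y where y: "encode y = encode (l x)" "h x = g (x, y)"
          using h(2)[OF False] by blast
        let ?s3 = "s2(n := encode (x, y))"
        have r3: "runs (Assign n (Join (Get n) (Get (n+1)))) n s2 (1 + ?w x) ?s3"
          using runs_Assign[of n n "Join (Get n) (Get (n+1))" s2] s2 s2' by (simp add: y)
        obtain s4 where r4: "runs (d n) n ?s3 (b1 (x, y)) s4" "s4 n = encode (g (x, y))"
          using d[of ?s3 n "(x, y)"] by auto
        have "b1 (x, y) \<le> poly q (?w x)"
          using q[of "(x, y)"] by (simp add: y)
        then have "runs (Seq (Assign n (Join (Get n) (Get (n+1)))) (d n)) n s2
            (b x + ((1 + ?w x) + poly q (?w x))) s4"
          using runs_mono[OF runs_Seq[OF r3 r4(1), of n]] by simp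
        then show ?thesis
          using False s2 y r4 by (intro that[of s4] runs_Cond) auto
      qed
      have "runs (?c n) n s (?b x) s4"
        by (rule runs_Seq[OF r1 runs_Seq[OF r2 r4, of n]]) simp_all
      then show ?thesis using s4 by blast
    qed
  qed
qed

lemma poly_time_case_list [poly_time_intros]:
  assumes l: "poly_time l" and f: "poly_time f"
    and g: "poly_time (\<lambda>p. g (fst p) (fst (snd p)) (snd (snd p)))"
  shows "poly_time (\<lambda>x. case l x of [] \<Rightarrow> f x | a # as \<Rightarrow> g x a as)"
proof (rule poly_time_branch[OF l f g])
  show "(case l x of [] \<Rightarrow> f x | a # as \<Rightarrow> g x a as) = f x" if "encode (l x) = Leaf" for x
    using that by (cases "l x") simp_all
  show "\<exists>y. encode y = encode (l x) \<and> (case l x of [] \<Rightarrow> f x | a # as \<Rightarrow> g x a as) =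
      g (fst (x, y)) (fst (snd (x, y))) (snd (snd (x, y)))" if "encode (l x) \<noteq> Leaf" for x
    using that by (cases "l x") (auto intro: exI[of _ "(hd (l x), tl (l x))"])
qed

lemma poly_time_if [poly_time_intros]:
  assumes b: "poly_time b" and f: "poly_time f" and g: "poly_time g"
  shows "poly_time (\<lambda>x. if b x then f x else g x)"
proof (rule poly_time_branch[OF b g poly_time_comp[OF f poly_time_fst[OF poly_time_id]]])
  show "(if b x then f x else g x) = g x" if "encode (b x) = Leaf" for x
    using that by (auto simp: enc_bool_def split: if_splits)
  show "\<exists>y. encode y = encode (b x) \<and> (if b x then f x else g x) = f (fst (x, y :: bool))"
    if "encode (b x) \<noteq> Leaf" for x
    using that by (auto simp: enc_bool_def split: if_splits intro!: exI[of _ "b x"])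
qed

lemma poly_time_is_Leaf [poly_time_intros]:
  assumes f: "poly_time f"
  shows "poly_time (\<lambda>x. f x = Leaf)"
  by (rule poly_time_branch[OF f poly_time_const[of True] poly_time_const[of False]])
    (auto intro: exI[of _ "_ :: tree"])

lemma poly_time_not [poly_time_intros]: "poly_time f \<Longrightarrow> poly_time (\<lambda>x. \<not> f x)"
  using poly_time_if[OF _ poly_time_const[of False] poly_time_const[of True], of f]
  by (simp add: if_bool_eq_conj)

lemma poly_time_imp [poly_time_intros]:
  "poly_time f \<Longrightarrow> poly_time g \<Longrightarrow> poly_time (\<lambda>x. f x \<longrightarrow> g x)"
  using poly_time_if[OF _ _ poly_time_const[of True], of f g] by (simp add: if_bool_eq_conj)

lemma poly_time_conj [poly_time_intros]:
  "poly_time f \<Longrightarrow> poly_time g \<Longrightarrow> poly_time (\<lambda>x. f x \<and> g x)"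
  using poly_time_not[OF poly_time_imp[OF _ poly_time_not], of f g] by simp

lemma poly_time_disj [poly_time_intros]:
  "poly_time f \<Longrightarrow> poly_time g \<Longrightarrow> poly_time (\<lambda>x. f x \<or> g x)"
  unfolding disj_imp by (intro poly_time_imp poly_time_not)

subsection \<open>Loops\<close>

text \<open>Here \<open>r\<close> is the result of iterating \<open>F\<close> until the left subtree
  of the code is empty. The measure \<open>m\<close> bounds the number of rounds. The potential
  \<open>q\<close> never increases and dominates the size of every state reached, so one polynomial
  in \<open>q x\<close> bounds the cost of each round.\<close>

lemma poly_time_while:
  assumes F: "poly_time F"
    and stop: "\<And>x. left (encode x) = Leaf \<Longrightarrow> r x = x"
    and step: "\<And>x. left (encode x) \<noteq> Leaf \<Longrightarrow> r (F x) = r x"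
    and measure: "\<And>x. left (encode x) \<noteq> Leaf \<Longrightarrow> m (F x) < m x"
    and potential: "\<And>x. left (encode x) \<noteq> Leaf \<Longrightarrow> q (F x) \<le> q x"
    and size: "\<And>x. encode_size x \<le> q x"
    and m: "poly_bounded m" and q: "poly_bounded q"
  shows "poly_time r"
proof -
  obtain b c where b: "poly_bounded b"
    and c: "\<And>n s x. s n = encode x \<Longrightarrow> \<exists>s'. runs (c n) n s (b x) s' \<and> s' n = encode (F x)"
    using F by (rule poly_timeE) blast
  obtain p where p: "\<And>x. b x \<le> poly p (encode_size x)"
    using b by (rule poly_boundedE) blast
  let ?w = "\<lambda>n. While (Left (Get n)) (c n)"
  let ?b = "\<lambda>x. 1 + m x * (1 + poly p (q x))"
  show ?thesis
  proof (rule poly_timeI[where b = ?b and c = ?w])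
    show "poly_bounded ?b"
      by (intro poly_bounded_intros m q)
    show "\<exists>s'. runs (?w n) n s (?b x) s' \<and> s' n = encode (r x)" if "s n = encode x" for n s x
      using that
    proof (induction "m x" arbitrary: s x rule: less_induct)
      case less
      show ?case
      proof (cases "left (encode x) = Leaf")
        case True
        then show ?thesis
          using less.prems stop[OF True]
          by (intro exI[of _ s]) (auto intro!: runs_mono[OF runs_WhileFalse])
      next
        case False
        obtain s1 where r1: "runs (c n) n s (b x) s1" and s1: "s1 n = encode (F x)"
          using c[of s n x] less.prems by blast
        obtain s2 where r2: "runs (?w n) n s1 (?b (F x)) s2" and s2: "s2 n = encode (r (F x))"
          using less.hyps[of "F x" s1, OF measure[OF False] s1] by blast
        have "b x \<le> poly p (q x)"
          using p[of x] poly_nat_mono[OF size] by (rule le_trans)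
        moreover have "m (F x) * (1 + poly p (q (F x))) \<le> m (F x) * (1 + poly p (q x))"
          using poly_nat_mono[OF potential[OF False]] by simp
        moreover have "1 + poly p (q x) + m (F x) * (1 + poly p (q x)) \<le> m x * (1 + poly p (q x))"
          using mult_le_mono1[of "1 + m (F x)" "m x" "1 + poly p (q x)"] measure[OF False]
          by simp
        ultimately have "1 + b x + ?b (F x) \<le> ?b x"
          by linarith
        moreover have "runs (?w n) n s (1 + b x + ?b (F x)) s2"
          using False less.prems by (intro runs_WhileTrue[OF _ r1 r2]) simp
        ultimately have "runs (?w n) n s (?b x) s2"
          by (rule runs_mono[rotated])
        then show ?thesis
          using s2 step[OF False] by (intro exI[of _ s2]) simp
      qed
    qed
  qed
qed

text \<open>Additive growth in each round is required since repeated doubling would make the values grow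
  exponentially.\<close>

lemma poly_time_fold:
  fixes f :: "'e::encodable \<Rightarrow> 'a::encodable \<Rightarrow> 's::encodable \<Rightarrow> 's"
  assumes f: "poly_time (\<lambda>p. f (fst p) (fst (snd p)) (snd (snd p)))"
    and size: "\<And>x a s. encode_size (f x a s) \<le> encode_size s + q (x, a)"
    and q: "poly_bounded q"
    and l: "poly_time l" and s: "poly_time s0"
  shows "poly_time (\<lambda>x. fold (f x) (l x) (s0 x))"
proof -
  obtain p where p: "\<And>x. q x \<le> poly p (encode_size x)"
    using q by (rule poly_boundedE) blast
  \<comment> \<open>The state holds the elements still to be processed, the fixed parameter and the
    accumulator. The loop stops when the first component is empty.\<close>
  let ?F = "\<lambda>(y :: 'a list \<times> 'e \<times> 's). case fst y of [] \<Rightarrow> y | a # as \<Rightarrow>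
    (as, fst (snd y), f (fst (snd y)) a (snd (snd y)))"
  let ?r = "\<lambda>(y :: 'a list \<times> 'e \<times> 's).
    ([] :: 'a list, fst (snd y), fold (f (fst (snd y))) (fst y) (snd (snd y)))"
  \<comment> \<open>The potential pays in advance for the growth that the remaining elements may
    cause: each round trades the summand of its element for the growth of the accumulator.\<close>
  let ?q = "\<lambda>(y :: 'a list \<times> 'e \<times> 's). encode_size y + sum_list (map (\<lambda>a. q (fst (snd y), a)) (fst y))"
  have f': "poly_time (\<lambda>p. f (F1 p) (F2 p) (F3 p))"
    if "poly_time F1" "poly_time F2" "poly_time F3"
    for F1 :: "'c::encodable \<Rightarrow> 'e" and F2 F3
    using poly_time_comp[OF f poly_time_Pair[OF that(1) poly_time_Pair[OF that(2,3)]]] by simp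
  have "poly_time ?r"
  proof (rule poly_time_while[where F = ?F and m = "\<lambda>y. length (fst y)" and q = ?q])
    show "poly_time ?F"
      by (intro poly_time_intros f')
    fix y :: "'a list \<times> 'e \<times> 's"
    obtain as x s where y: "y = (as, x, s)" by (cases y) auto
    show "?r y = y" if "left (encode y) = Leaf"
      using that by (cases as) (simp_all add: y)
    show "encode_size y \<le> ?q y" by simp
    assume "left (encode y) \<noteq> Leaf"
    then obtain b bs where as: "as = b # bs" by (cases as) (simp_all add: y)
    show "?r (?F y) = ?r y" "length (fst (?F y)) < length (fst y)"
      by (simp_all add: y as)
    show "?q (?F y) \<le> ?q y"
      using size[of x b s] by (simp add: y as)
  next
    show "poly_bounded (\<lambda>y :: 'a list \<times> 'e \<times> 's. length (fst y))"
      by (rule poly_bounded_mono[OF poly_bounded_encode_size])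
        (simp add: encode_prod_def le_trans[OF length_le_encode_size] trans_le_add1)
    have "?q y \<le> encode_size y + encode_size y * poly p (encode_size y)" for y :: "'a list \<times> 'e \<times> 's"
    proof -
      obtain as x s where y: "y = (as, x, s)" by (cases y) auto
      have "q (x, a) \<le> poly p (encode_size y)" if "a \<in> set as" for a
      proof -
        have "encode_size (x, a) \<le> encode_size y"
          using encode_size_mem[OF that] by (simp add: y)
        then show ?thesis
          by (rule order.trans[OF p poly_nat_mono])
      qed
      then have "sum_list (map (\<lambda>a. q (x, a)) as) \<le> sum_list (map (\<lambda>a. poly p (encode_size y)) as)"
        by (rule sum_list_mono)
      also have "\<dots> = length as * poly p (encode_size y)"
        by (simp add: sum_list_triv)
      also have "\<dots> \<le> encode_size y * poly p (encode_size y)"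
        using length_le_encode_size[of as] by (intro mult_le_mono1) (simp add: y)
      finally show ?thesis by (simp add: y)
    qed
    then show "poly_bounded ?q"
      by (rule poly_bounded_mono[rotated]) (intro poly_bounded_intros)
  qed
  moreover have "poly_time (\<lambda>x. (l x, x, s0 x))"
    by (intro poly_time_intros l s)
  ultimately have "poly_time (\<lambda>x. snd (snd (?r (l x, x, s0 x))))"
    by (rule poly_time_snd[OF poly_time_snd[OF poly_time_comp]])
  then show ?thesis by simp
qed

section \<open>List operations as folds\<close>

lemma poly_time_rev [THEN poly_time_comp, poly_time_intros]:
  "poly_time (rev :: 'a::encodable list \<Rightarrow> 'a list)"
  unfolding rev_conv_fold
  by (rule poly_time_fold[where q = "\<lambda>p. 1 + encode_size (snd p)"]; (simp; fail)?)
    (intro poly_time_intros poly_bounded_intros poly_bounded_encode_size_poly_time)+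

lemma poly_time_append [poly_time_intros]:
  assumes "poly_time f" "poly_time g"
  shows "poly_time (\<lambda>x. f x @ g x)"
proof -
  have "poly_time (\<lambda>x. fold Cons (rev (f x)) (g x))"
    by (rule poly_time_fold[where q = "\<lambda>p. 1 + encode_size (snd p)"]; (simp; fail)?)
      (intro poly_time_intros poly_bounded_intros poly_bounded_encode_size_poly_time assms)+
  then show ?thesis by (simp add: fold_Cons_rev)
qed

lemma poly_time_map [poly_time_intros]:
  assumes f: "poly_time (\<lambda>p. f (fst p) (snd p))" and l: "poly_time l"
  shows "poly_time (\<lambda>x. map (f x) (l x))"
proof -
  have "fold (\<lambda>a s. f x a # s) as s = rev (map (f x) as) @ s" for x as s
    by (induction as arbitrary: s) simp_all
  moreover have "poly_time (\<lambda>x. fold (\<lambda>a s. f x a # s) (l x) [])"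
    by (rule poly_time_fold[where q = "\<lambda>p. 1 + encode_size (f (fst p) (snd p))"]; (simp; fail)?)
      (intro poly_time_intros poly_bounded_intros poly_bounded_encode_size_poly_time f l
        poly_time_comp2[of f])+
  ultimately have "poly_time (\<lambda>x. rev (map (f x) (l x)))" by simp
  from poly_time_rev[OF this] show ?thesis by simp
qed

lemma poly_time_filter [poly_time_intros]:
  assumes P: "poly_time (\<lambda>p. P (fst p) (snd p))" and l: "poly_time l"
  shows "poly_time (\<lambda>x. filter (P x) (l x))"
proof -
  have "fold (\<lambda>a s. if P x a then a # s else s) as s = rev (filter (P x) as) @ s" for x as s
    by (induction as arbitrary: s) simp_all
  moreover have "poly_time (\<lambda>x. fold (\<lambda>a s. if P x a then a # s else s) (l x) [])"
    by (rule poly_time_fold[where q = "\<lambda>p. 1 + encode_size (snd p)"]; (simp; fail)?)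
      (intro poly_time_intros poly_bounded_intros poly_bounded_encode_size_poly_time P l
        poly_time_comp2[of P])+
  ultimately have "poly_time (\<lambda>x. rev (filter (P x) (l x)))" by simp
  from poly_time_rev[OF this] show ?thesis by simp
qed

lemma poly_time_concat [THEN poly_time_comp, poly_time_intros]:
  "poly_time (concat :: 'a::encodable list list \<Rightarrow> 'a list)"
proof -
  have "fold (\<lambda>a s. s @ a) as s = s @ concat as" for as and s :: "'a list"
    by (induction as arbitrary: s) simp_all
  moreover have "poly_time (\<lambda>x :: 'a list list. fold (\<lambda>a s. s @ a) x [])"
    by (rule poly_time_fold[where q = "\<lambda>p. encode_size (snd p)"]; (simp add: encode_size_append; fail)?)
      (intro poly_time_intros poly_bounded_intros poly_bounded_encode_size_poly_time)+
  ultimately show ?thesis by simp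
qed

lemma poly_time_Ball [poly_time_intros]:
  assumes P: "poly_time (\<lambda>p. P (fst p) (snd p))" and l: "poly_time l"
  shows "poly_time (\<lambda>x. \<forall>a\<in>set (l x). P x a)"
proof -
  have "fold (\<lambda>a s. s \<and> P x a) as s = (s \<and> (\<forall>a\<in>set as. P x a))" for x as s
    by (induction as arbitrary: s) auto
  moreover have "poly_time (\<lambda>x. fold (\<lambda>a s. s \<and> P x a) (l x) True)"
    by (rule poly_time_fold[where q = "\<lambda>p. 1"]; (simp add: encode_size_bool trans_le_add2 del: One_nat_def encode_bool_def; fail)?)
      (intro poly_time_intros poly_bounded_intros P l poly_time_comp2[of P])+
  ultimately show ?thesis by simp
qed

lemma poly_time_Bex [poly_time_intros]:
  assumes P: "poly_time (\<lambda>p. P (fst p) (snd p))" and l: "poly_time l"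
  shows "poly_time (\<lambda>x. \<exists>a\<in>set (l x). P x a)"
  using poly_time_not[OF poly_time_Ball[OF poly_time_not[OF P] l]] by simp

lemma poly_time_zip [poly_time_intros]:
  assumes "poly_time f" "poly_time g"
  shows "poly_time (\<lambda>x. zip (f x) (g x))"
proof -
  let ?step = "\<lambda>a s. case snd s of [] \<Rightarrow> s | b # bs \<Rightarrow> (fst s @ [(a, b)], bs)"
  have "fst (fold ?step as (zs, bs)) = zs @ zip as bs"
    for as :: "'b list" and bs :: "'c list" and zs
  proof (induction as arbitrary: bs zs)
    case (Cons a as)
    then show ?case by (cases bs) simp_all
  qed simp
  moreover have "poly_time (\<lambda>x. fst (fold ?step (f x) ([], g x)))"
  \<comment> \<open>The element \<open>b\<close> only moves from the remaining list to the result,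
    so the growth is bounded in terms of \<open>a\<close> alone.\<close>
  proof (rule poly_time_fst, rule poly_time_fold[where q = "\<lambda>p. 3 + encode_size (snd p)"])
    show "encode_size (?step a s) \<le> encode_size s + (3 + encode_size (snd (x, a)))"
      for x :: 'a and a :: 'b and s :: "('b \<times> 'c) list \<times> 'c list"
      by (cases s; cases "snd s") (simp_all add: encode_size_append)
  qed (intro poly_time_intros poly_bounded_intros poly_bounded_encode_size_poly_time assms)+
  ultimately show ?thesis by simp
qed

text \<open>This is where \<open>k\<close> must be constant: the induction on \<open>k\<close> takes
  place outside the programs and yields one program for each \<open>k\<close>. The number of tuples
  is the \<open>k\<close>-th power of the length of the list.\<close>

lemma poly_time_n_lists: "poly_time l \<Longrightarrow> poly_time (\<lambda>x. List.n_lists k (l x))"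
proof (induction k)
  case (Suc k)
  have "poly_time (\<lambda>x. concat (map (\<lambda>ys. map (\<lambda>y. y # ys) (l x)) (List.n_lists k (l x))))"
    by (intro poly_time_intros Suc poly_time_comp[OF Suc.prems])
  then show ?case by simp
qed (simp add: poly_time_const)

declare poly_time_n_lists [poly_time_intros]

subsection \<open>Equality\<close>

text \<open>Two trees are compared by applying the same size-preserving right rotations to both until
  their left subtrees are empty, which needs no stack. This function counts the remaining steps.\<close>

fun comparison_steps :: "tree \<Rightarrow> nat" where
  "comparison_steps Leaf = 0"
| "comparison_steps (Node a b) = 1 + 2 * size a + comparison_steps b"

lemma comparison_steps_le: "comparison_steps a \<le> 2 * size a"
  by (induction a) simp_all

lemma poly_time_tree_eq: "poly_time (\<lambda>p :: tree \<times> tree. fst p = snd p)"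
proof -
  \<comment> \<open>The flag in the first component says whether the comparison is still running.
    \<open>?stop\<close> describes the trees for which the answer is evident: at least one is empty,
    or exactly one has an empty left subtree.\<close>
  let ?stop = "\<lambda>y :: bool \<times> tree \<times> tree. fst (snd y) = Leaf \<or> snd (snd y) = Leaf \<or>
    left (fst (snd y)) = Leaf \<and> left (snd (snd y)) \<noteq> Leaf \<or>
    left (fst (snd y)) \<noteq> Leaf \<and> left (snd (snd y)) = Leaf"
  \<comment> \<open>This rotation is injective on trees with a nonempty left subtree, so it
    preserves and reflects equality.\<close>
  let ?rot = "\<lambda>a. Node (left (left a)) (Node (right (left a)) (right a))"
  \<comment> \<open>The verdict is left in the second component, where \<open>Leaf\<close> means
    that the trees are equal.\<close>
  let ?F = "\<lambda>y :: bool \<times> tree \<times> tree.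
    if ?stop y then (False, if fst (snd y) = Leaf \<and> snd (snd y) = Leaf then Leaf else Node Leaf Leaf, Leaf)
    else if left (fst (snd y)) = Leaf then (True, right (fst (snd y)), right (snd (snd y)))
    else (True, ?rot (fst (snd y)), ?rot (snd (snd y)))"
  let ?r = "\<lambda>y :: bool \<times> tree \<times> tree.
    if fst y then (False, if fst (snd y) = snd (snd y) then Leaf else Node Leaf Leaf, Leaf) else y"
  \<comment> \<open>The additional 1 pays for the last round, which clears the flag.\<close>
  let ?m = "\<lambda>y :: bool \<times> tree \<times> tree. if fst y then 1 + comparison_steps (fst (snd y)) else 0"
  have F_cases: "\<exists>a b. y = (True, a, b) \<and>
      (?stop y \<or> (\<exists>a' b'. a = Node Leaf a' \<and> b = Node Leaf b') \<or>
        (\<exists>a1 a2 a3 b1 b2 b3. a = Node (Node a1 a2) a3 \<and> b = Node (Node b1 b2) b3))"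
    if y_Leaf: "left (encode y) \<noteq> Leaf" for y :: "bool \<times> tree \<times> tree"
  proof -
    obtain a b where y: "y = (True, a, b)"
      using y_Leaf by (cases y) (auto simp: enc_bool_def split: if_splits)
    show ?thesis
      unfolding y by (cases a; cases b; cases "left a"; cases "left b") auto
  qed
  have "poly_time ?r"
  proof (rule poly_time_while[where F = ?F and m = ?m and q = encode_size])
    show "poly_time ?F" by (intro poly_time_intros)
    show "poly_bounded ?m"
    proof (rule poly_bounded_mono)
      show "poly_bounded (\<lambda>y :: bool \<times> tree \<times> tree. 1 + 2 * encode_size y)"
        by (intro poly_bounded_intros)
      show "?m y \<le> 1 + 2 * encode_size y" for y
        using comparison_steps_le[of "fst (snd y)"] by (cases y) simp
    qed
    fix y :: "bool \<times> tree \<times> tree"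
    show "?r y = y" if "left (encode y) = Leaf"
      using that by (cases y) (auto simp: enc_bool_def split: if_splits)
    assume y: "left (encode y) \<noteq> Leaf"
    show "?r (?F y) = ?r y"
      using F_cases[OF y] by (elim exE conjE disjE) (auto split: if_splits)
    show "?m (?F y) < ?m y"
      using F_cases[OF y] by (elim exE conjE disjE) (auto split: if_splits)
    show "encode_size (?F y) \<le> encode_size y"
      using F_cases[OF y] by (elim exE conjE disjE) (auto simp: enc_bool_def split: if_splits)
  qed (simp_all add: poly_bounded_encode_size)
  moreover have "poly_time (\<lambda>p :: tree \<times> tree. (True, p))"
    by (intro poly_time_intros)
  ultimately have "poly_time (\<lambda>p :: tree \<times> tree. fst (snd (?r (True, p))) = Leaf)"
    by (rule poly_time_is_Leaf[OF poly_time_fst[OF poly_time_snd[OF poly_time_comp]]])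
  moreover have "(fst (snd (?r (True, p))) = Leaf) = (fst p = snd p)" for p
    by simp
  ultimately show ?thesis by (simp only:)
qed

lemma poly_time_eq [poly_time_intros]:
  assumes "poly_time f" "poly_time g"
  shows "poly_time (\<lambda>x. f x = g x)"
  using poly_time_comp[OF poly_time_tree_eq, of "\<lambda>x. (encode (f x), encode (g x))"]
    poly_time_Pair[OF assms[THEN poly_time_encode]] by simp

section \<open>The algorithm\<close>

text \<open>A literal of the least general generalization is represented by a literal of the first
  positive example together with its list of columns. The column of an argument position lists the
  terms at this position in the corresponding literals of all positive examples, and it stands for
  a constant if these terms are one and the same constant, and for a variable otherwise.\<close>

type_synonym column_literal = "literal \<times> trm list list"

fun is_constant :: "trm \<Rightarrow> bool" where
  "is_constant (Var x) \<longleftrightarrow> False"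
| "is_constant (Fun f ts) \<longleftrightarrow> ts = []"

definition constant_column :: "trm list \<Rightarrow> bool" where
  "constant_column c \<longleftrightarrow> (\<forall>t\<in>set c. is_constant t \<and> (\<forall>u\<in>set c. t = u))"

text \<open>In a straight example at most one literal qualifies. The default \<open>L\<close> is
  returned only if there is none, a case that the filter in \<open>lgg\<close> excludes.\<close>

definition counterpart :: "literal list \<Rightarrow> literal \<Rightarrow> literal" where
  "counterpart C L =
     (case filter (\<lambda>N. signed_relation N = signed_relation L) C of [] \<Rightarrow> L | N # Ns \<Rightarrow> N)"

text \<open>A transposition of the argument lists of the counterparts, written as a fold so that a
  loop computes it. The description by positions is \<open>columns_eq\<close>.\<close>

definition columns :: "literal list list \<Rightarrow> literal \<Rightarrow> trm list list" where
  "columns Ps L = foldr (\<lambda>C cs. map (\<lambda>p. fst p # snd p) (zip (arguments (counterpart C L)) cs))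
     Ps (map (\<lambda>t. []) (arguments L))"

definition lgg :: "literal list list \<Rightarrow> column_literal list" where
  "lgg Ps = map (\<lambda>L. (L, columns Ps L))
     (filter (\<lambda>L. \<forall>C\<in>set Ps. \<exists>N\<in>set C. signed_relation N = signed_relation L)
       (case Ps of [] \<Rightarrow> [] | C # Cs \<Rightarrow> C))"

text \<open>Equal columns stand for the same variable, so this says that all variables of
  \<open>K\<close> occur in \<open>S\<close>.\<close>

definition covers :: "column_literal list \<Rightarrow> column_literal \<Rightarrow> bool" where
  "covers S K \<longleftrightarrow> (\<forall>c\<in>set (snd K). constant_column c \<or> (\<exists>M\<in>set S. c \<in> set (snd M)))"

text \<open>With columns in the role of variables, these are the assignments forced by sending the
  literals of \<open>S\<close> to those of \<open>T\<close> position by position. They describe a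
  substitution only if they are \<open>functional\<close>.\<close>

definition bindings :: "column_literal list \<Rightarrow> literal list \<Rightarrow> (trm list \<times> trm) list" where
  "bindings S T = concat (map (\<lambda>p. zip (snd (fst p)) (arguments (snd p))) (zip S T))"

definition functional :: "('a \<times> 'b) list \<Rightarrow> bool" where
  "functional A \<longleftrightarrow> (\<forall>p\<in>set A. \<forall>q\<in>set A. fst p = fst q \<longrightarrow> snd p = snd q)"

text \<open>All members of a nonempty constant column are one and the same constant, so membership
  in it means equality with this constant.\<close>

definition maps_to :: "(trm list \<times> trm) list \<Rightarrow> column_literal \<Rightarrow> literal \<Rightarrow> bool" where
  "maps_to A K N \<longleftrightarrow> signed_relation (fst K) = signed_relation N \<and>
     (\<forall>p\<in>set (zip (snd K) (arguments N)).
        if constant_column (fst p) then snd p \<in> set (fst p) else p \<in> set A)"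

text \<open>Once \<open>T\<close> is chosen and its bindings are functional, each nonconstant column
  has at most one admissible value. The literals of \<open>H\<close> can then be matched
  independently of each other, without a search over substitutions.\<close>

definition subsumption_test ::
  "nat \<Rightarrow> column_literal list \<Rightarrow> column_literal list \<Rightarrow> literal list \<Rightarrow> bool" where
  "subsumption_test k S H D \<longleftrightarrow> (\<exists>T\<in>set (List.n_lists k D). functional (bindings S T) \<and>
     (\<forall>K\<in>set H. \<exists>N\<in>set D. maps_to (bindings S T) K N))"

definition consistency_test :: "nat \<Rightarrow> literal list list \<Rightarrow> literal list list \<Rightarrow> bool" where
  "consistency_test k Ps Ns \<longleftrightarrow> Ps = [] \<or> (\<exists>S\<in>set (List.n_lists k (lgg Ps)).
     filter (covers S) (lgg Ps) \<noteq> [] \<and>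
     (\<forall>D\<in>set Ns. \<not> subsumption_test k S (filter (covers S) (lgg Ps)) D))"

subsection \<open>Running time\<close>

lemma poly_time_is_constant [THEN poly_time_comp, poly_time_intros]: "poly_time is_constant"
proof -
  have "is_constant t \<longleftrightarrow> left (encode t) \<noteq> Leaf \<and> right (right (encode t)) = Leaf" for t
    by (cases t) (auto simp: enc_bool_def elim: enc_list.elims)
  moreover have "poly_time (\<lambda>t :: trm. left (encode t) \<noteq> Leaf \<and> right (right (encode t)) = Leaf)"
    by (intro poly_time_intros)
  ultimately show ?thesis by presburger
qed

lemma poly_time_signed_relation_eq [poly_time_intros]:
  assumes "poly_time f" "poly_time g"
  shows "poly_time (\<lambda>x. signed_relation (f x) = signed_relation (g x))"
proof -
  \<comment> \<open>Numbers are not given codes, so lengths are compared in unary.\<close>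
  have "length xs = length ys \<longleftrightarrow> map (\<lambda>_. True) xs = map (\<lambda>_. True) ys"
    for xs ys :: "trm list"
    by (simp add: map_replicate_const)
  then show ?thesis
    unfolding signed_relation_def prod.inject by (simp only:) (intro poly_time_intros assms)
qed

lemma poly_time_mem [poly_time_intros]:
  assumes "poly_time f" "poly_time g"
  shows "poly_time (\<lambda>x. f x \<in> set (g x))"
proof -
  have "poly_time (\<lambda>x. \<exists>a\<in>set (g x). a = f x)"
    by (intro poly_time_intros assms poly_time_comp[OF assms(1)])
  then show ?thesis by simp
qed

lemma poly_time_constant_column [THEN poly_time_comp, poly_time_intros]: "poly_time constant_column"
  unfolding constant_column_def by (intro poly_time_intros)

lemma poly_time_counterpart [THEN poly_time_comp2, poly_time_intros]:
  "poly_time (\<lambda>p. counterpart (fst p) (snd p))"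
  unfolding counterpart_def by (intro poly_time_intros)

lemma poly_time_columns [THEN poly_time_comp2, poly_time_intros]:
  "poly_time (\<lambda>p. columns (fst p) (snd p))"
proof -
  let ?f = "\<lambda>(p :: literal list list \<times> literal) C cs.
    map (\<lambda>p. fst p # snd p) (zip (arguments (counterpart C (snd p))) cs)"
  \<comment> \<open>As \<open>zip\<close> truncates, a round adds at most the code of one argument
    list. This is the additive growth required by \<open>poly_time_fold\<close>.\<close>
  have zip_size: "encode_size (map (\<lambda>p. fst p # snd p) (zip ts cs)) \<le> encode_size cs + encode_size ts"
    for ts :: "trm list" and cs
  proof (induction ts arbitrary: cs)
    case (Cons t ts)
    show ?case
      using Cons.IH[of "tl cs"] by (cases cs) simp_all
  qed simp
  have "poly_time (\<lambda>p. fold (?f p) (rev (fst p)) (map (\<lambda>t. []) (arguments (snd p))))"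
  proof (rule poly_time_fold)
    show "encode_size (?f p C cs) \<le> encode_size cs +
        (\<lambda>q. encode_size (arguments (counterpart (snd q) (snd (fst q))))) (p, C)" for p C cs
      using zip_size by simp
    show "poly_bounded (\<lambda>q :: (literal list list \<times> literal) \<times> literal list.
        encode_size (arguments (counterpart (snd q) (snd (fst q)))))"
      by (intro poly_bounded_encode_size_poly_time poly_time_intros)
  qed (intro poly_time_intros)+
  then show ?thesis
    unfolding columns_def foldr_conv_fold .
qed

lemma poly_time_lgg [THEN poly_time_comp, poly_time_intros]: "poly_time lgg"
  unfolding lgg_def by (intro poly_time_intros)

lemma poly_time_covers [THEN poly_time_comp2, poly_time_intros]:
  "poly_time (\<lambda>p. covers (fst p) (snd p))"
  unfolding covers_def by (intro poly_time_intros)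

lemma poly_time_bindings [THEN poly_time_comp2, poly_time_intros]:
  "poly_time (\<lambda>p. bindings (fst p) (snd p))"
  unfolding bindings_def by (intro poly_time_intros)

lemma poly_time_functional [THEN poly_time_comp, poly_time_intros]:
  "poly_time (functional :: ('a::encodable \<times> 'b::encodable) list \<Rightarrow> bool)"
  unfolding functional_def by (intro poly_time_intros)

lemma poly_time_maps_to:
  assumes "poly_time f" "poly_time g" "poly_time h"
  shows "poly_time (\<lambda>x. maps_to (f x) (g x) (h x))"
proof -
  have "poly_time (\<lambda>p. maps_to (fst p) (fst (snd p)) (snd (snd p)))"
    unfolding maps_to_def by (intro poly_time_intros)
  from poly_time_comp[OF this poly_time_Pair[OF assms(1) poly_time_Pair[OF assms(2,3)]]]
  show ?thesis by simp
qed

lemma poly_time_subsumption_test: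
  assumes "poly_time f" "poly_time g" "poly_time h"
  shows "poly_time (\<lambda>x. subsumption_test k (f x) (g x) (h x))"
proof -
  have "poly_time (\<lambda>p. subsumption_test k (fst p) (fst (snd p)) (snd (snd p)))"
    unfolding subsumption_test_def by (intro poly_time_intros poly_time_maps_to)
  from poly_time_comp[OF this poly_time_Pair[OF assms(1) poly_time_Pair[OF assms(2,3)]]]
  show ?thesis by simp
qed

lemma poly_time_consistency_test: "poly_time (\<lambda>p. consistency_test k (fst p) (snd p))"
  unfolding consistency_test_def by (intro poly_time_intros poly_time_subsumption_test)

lemma decidable_in_polynomial_time_if_poly_time:
  assumes "poly_time P"
  shows "decidable_in_polynomial_time I encode P"
proof -
  obtain b c where b: "poly_bounded b"
    and c: "\<And>n s x. s n = encode x \<Longrightarrow> \<exists>s'. runs (c n) n s (b x) s' \<and> s' n = encode (P x)"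
    using assms by (rule poly_timeE) blast
  obtain p where p: "\<And>x. b x \<le> poly p (encode_size x)"
    using b by (rule poly_boundedE) blast
  have "\<exists>t s. exec (c 0) (initial_state (encode x)) t s \<and> t \<le> poly p (encode_size x) \<and>
      (s 0 \<noteq> Leaf \<longleftrightarrow> P x)" for x
  proof -
    have "initial_state (encode x) 0 = encode x"
      by (simp add: initial_state_def)
    from c[of "initial_state (encode x)" 0 x, OF this]
    obtain t s where "exec (c 0) (initial_state (encode x)) t s" "t \<le> b x" "s 0 = encode (P x)"
      by (auto simp: runs_def)
    then show ?thesis
      using p[of x] by (intro exI[of _ t] exI[of _ s]) (auto simp: enc_bool_def)
  qed
  then show ?thesis
    unfolding decidable_in_polynomial_time_def by blast
qed

subsection \<open>Correctness\<close>

text \<open>Making all relations constantly true or constantly false, according to the sign of one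
  literal of \<open>H\<close>, satisfies this literal under every valuation. The empty clause fails
  since a nonempty universe admits a valuation.\<close>

lemma consistent_singleton_iff: "consistent {H} \<longleftrightarrow> H \<noteq> {}"
proof
  assume "consistent {H}"
  then obtain U :: "nat set" and F R where U: "is_structure U F" and H: "true_clause U F R H"
    by (auto simp: consistent_def)
  then obtain u where "u \<in> U" by (auto simp: is_structure_def)
  then have "range (\<lambda>_. u) \<subseteq> U" by blast
  with H show "H \<noteq> {}" unfolding true_clause_def by blast
next
  assume "H \<noteq> {}"
  then obtain L where "L \<in> H" by blast
  then have "true_clause (UNIV :: nat set) (\<lambda>_ _. 0) (\<lambda>_ _. positive L) H"
    by (auto simp: true_clause_def true_literal_def)
  moreover have "is_structure (UNIV :: nat set) (\<lambda>_ _. 0)"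
    by (simp add: is_structure_def)
  ultimately show "consistent {H}"
    unfolding consistent_def by blast
qed

lemma signed_relation_subst_literal [simp]:
  "signed_relation (subst_literal \<theta> L) = signed_relation L"
  by (simp add: signed_relation_def subst_literal_def)

lemma literal_eqI:
  "signed_relation L = signed_relation M \<Longrightarrow> arguments L = arguments M \<Longrightarrow> L = M"
  by (cases L; cases M) (simp add: signed_relation_def)

lemma arguments_subst_literal [simp]:
  "arguments (subst_literal \<theta> L) = map (subst_trm \<theta>) (arguments L)"
  by (simp add: subst_literal_def)

section \<open>Columns of the generalization and their reading as terms\<close>

lemma counterpart_mem:
  assumes "\<exists>N\<in>set C. signed_relation N = signed_relation L"
  shows "counterpart C L \<in> set C" "signed_relation (counterpart C L) = signed_relation L"
proof -
  obtain N Ns where *: "filter (\<lambda>N. signed_relation N = signed_relation L) C = N # Ns"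
    using assms by (cases "filter (\<lambda>N. signed_relation N = signed_relation L) C")
      (auto simp: filter_empty_conv)
  then have "N \<in> set (filter (\<lambda>N. signed_relation N = signed_relation L) C)"
    by simp
  moreover have "counterpart C L = N"
    using * by (simp add: counterpart_def)
  ultimately show "counterpart C L \<in> set C" "signed_relation (counterpart C L) = signed_relation L"
    by simp_all
qed

lemma counterpart_eq:
  assumes "straight (set C)" "N \<in> set C" "signed_relation N = signed_relation L"
  shows "counterpart C L = N"
proof -
  have "\<exists>N\<in>set C. signed_relation N = signed_relation L" using assms by blast
  from counterpart_mem[OF this] show ?thesis
    using assms unfolding straight_def by (metis inj_onD)
qed

text \<open>Equal numbers of arguments keep the zips from truncating.\<close>

lemma columns_eq:
  assumes "\<forall>C\<in>set Ps. length (arguments (counterpart C L)) = length (arguments L)"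
  shows "columns Ps L = map (\<lambda>j. map (\<lambda>C. arguments (counterpart C L) ! j) Ps)
    [0..<length (arguments L)]"
  using assms
proof (induction Ps)
  case Nil
  show ?case by (rule nth_equalityI) (simp_all add: columns_def)
next
  case (Cons C Ps)
  have "columns (C # Ps) L =
      map (\<lambda>p. fst p # snd p) (zip (arguments (counterpart C L)) (columns Ps L))"
    by (simp add: columns_def)
  also have "columns Ps L = map (\<lambda>j. map (\<lambda>C. arguments (counterpart C L) ! j) Ps)
      [0..<length (arguments L)]"
    using Cons by simp
  finally show ?case
    using Cons.prems by (auto intro: nth_equalityI)
qed

text \<open>Variables are words, so using columns as variables requires an injective code by words.
  This preorder code is prefix-free.\<close>

fun tree_name :: "tree \<Rightarrow> name" where
  "tree_name Leaf = [False]"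
| "tree_name (Node a b) = True # tree_name a @ tree_name b"

text \<open>The remainders \<open>xs\<close> and \<open>ys\<close> carry the induction: while the
  first subtree is parsed, the word of the second one belongs to the remainder.\<close>

lemma tree_name_append_eq: "tree_name a @ xs = tree_name b @ ys \<Longrightarrow> a = b \<and> xs = ys"
proof (induction a arbitrary: b xs ys)
  case Leaf
  then show ?case by (cases b) simp_all
next
  case (Node a1 a2)
  show ?case
  proof (cases b)
    case Leaf
    then show ?thesis using Node.prems by simp
  next
    case b: (Node b1 b2)
    then have "tree_name a1 @ tree_name a2 @ xs = tree_name b1 @ tree_name b2 @ ys"
      using Node.prems by simp
    then have "a1 = b1" "tree_name a2 @ xs = tree_name b2 @ ys"
      using Node.IH(1) by blast+
    with b show ?thesis using Node.IH(2) by blast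
  qed
qed

definition column_name :: "trm list \<Rightarrow> name" where
  "column_name c = tree_name (encode c)"

lemma inj_column_name: "inj column_name"
proof (rule injI)
  fix c d assume "column_name c = column_name d"
  then show "c = d"
    using tree_name_append_eq[of "encode c" "[]" "encode d" "[]"] by (simp add: column_name_def)
qed

definition column_term :: "trm list \<Rightarrow> trm" where
  "column_term c = (if constant_column c then hd c else Var (column_name c))"

definition realize :: "column_literal \<Rightarrow> literal" where
  "realize K = Lit (positive (fst K)) (relation (fst K)) (map column_term (snd K))"

lemma constant_column_hd:
  assumes "constant_column c" "t \<in> set c"
  shows "hd c = t" "is_constant t"
proof -
  have "hd c \<in> set c" using assms(2) by (cases c) auto
  then show "hd c = t" "is_constant t" using assms by (auto simp: constant_column_def)
qed

lemma is_constantE: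
  assumes "is_constant t" obtains f where "t = Fun f []"
  using assms by (cases t) auto

lemma vars_column_term:
  assumes "c \<noteq> []"
  shows "vars_trm (column_term c) = (if constant_column c then {} else {column_name c})"
proof (cases "constant_column c")
  case True
  with assms have "is_constant (hd c)" by (intro constant_column_hd) auto
  then show ?thesis using True by (auto simp: column_term_def elim: is_constantE)
qed (simp add: column_term_def)

lemma lgg_mem:
  assumes "K \<in> set (lgg Ps)"
  shows "C \<in> set Ps \<Longrightarrow> counterpart C (fst K) \<in> set C"
    and "C \<in> set Ps \<Longrightarrow> signed_relation (counterpart C (fst K)) = signed_relation (fst K)"
    and "snd K = map (\<lambda>j. map (\<lambda>C. arguments (counterpart C (fst K)) ! j) Ps)
      [0..<length (arguments (fst K))]"
proof -
  have ex: "\<forall>C\<in>set Ps. \<exists>N\<in>set C. signed_relation N = signed_relation (fst K)"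
    and K: "snd K = columns Ps (fst K)"
    using assms by (auto simp: lgg_def)
  have mem: "counterpart C (fst K) \<in> set C \<and>
      signed_relation (counterpart C (fst K)) = signed_relation (fst K)" if "C \<in> set Ps" for C
    using ex that counterpart_mem[of C "fst K"] by blast
  then show "C \<in> set Ps \<Longrightarrow> counterpart C (fst K) \<in> set C"
    "C \<in> set Ps \<Longrightarrow> signed_relation (counterpart C (fst K)) = signed_relation (fst K)"
    by blast+
  show "snd K = map (\<lambda>j. map (\<lambda>C. arguments (counterpart C (fst K)) ! j) Ps)
      [0..<length (arguments (fst K))]"
    unfolding K using mem by (intro columns_eq) (simp add: signed_relation_def)
qed

lemma signed_relation_realize: "K \<in> set (lgg Ps) \<Longrightarrow> signed_relation (realize K) = signed_relation (fst K)"
  using lgg_mem(3)[of K Ps] by (simp add: signed_relation_def realize_def)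

lemma length_column: "K \<in> set (lgg Ps) \<Longrightarrow> c \<in> set (snd K) \<Longrightarrow> length c = length Ps"
  using lgg_mem(3)[of K Ps] by auto

text \<open>Replacing each variable by the \<open>i\<close>-th entry of its column turns every
  literal back into its counterpart in the \<open>i\<close>-th example.\<close>

lemma subsumes_realize:
  assumes "H \<subseteq> set (lgg Ps)" "C \<in> set Ps"
  shows "realize ` H \<turnstile> set C"
proof -
  obtain i where i: "i < length Ps" "Ps ! i = C"
    using assms(2) by (auto simp: in_set_conv_nth)
  \<comment> \<open>The inverse of \<open>column_name\<close> recovers the column from the variable
    that names it.\<close>
  define \<theta> where "\<theta> = (\<lambda>x. inv column_name x ! i)"
  have \<theta>: "subst_trm \<theta> (column_term c) = c ! i" if "length c = length Ps" for c
  proof (cases "constant_column c")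
    case True
    with that i have "hd c = c ! i" "is_constant (c ! i)"
      using constant_column_hd[of c "c ! i"] by auto
    then show ?thesis
      using True by (auto simp: column_term_def elim!: is_constantE)
  qed (simp add: column_term_def \<theta>_def inv_f_f[OF inj_column_name])
  have "subst_literal \<theta> (realize K) = counterpart C (fst K)" if "K \<in> H" for K
  proof (rule literal_eqI)
    have K: "K \<in> set (lgg Ps)" using that assms by blast
    show *: "signed_relation (subst_literal \<theta> (realize K)) = signed_relation (counterpart C (fst K))"
      using K lgg_mem(2)[OF K assms(2)] by (simp add: signed_relation_realize)
    have "map (subst_trm \<theta> \<circ> column_term) (snd K) = map (\<lambda>c. c ! i) (snd K)"
      using \<theta> length_column[OF K] by simp
    also have "\<dots> = map ((!) (arguments (counterpart C (fst K)))) [0..<length (arguments (fst K))]"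
      by (subst lgg_mem(3)[OF K]) (simp add: comp_def i)
    also have "\<dots> = arguments (counterpart C (fst K))"
      using lgg_mem(2)[OF K assms(2)] by (intro nth_equalityI) (simp_all add: signed_relation_def)
    finally show "arguments (subst_literal \<theta> (realize K)) = arguments (counterpart C (fst K))"
      by (simp add: realize_def)
  qed
  then have "subst_literal \<theta> ` realize ` H \<subseteq> set C"
    using assms lgg_mem(1) by auto
  then show ?thesis
    unfolding subsumes_def by blast
qed

section \<open>Correctness of the test in both directions\<close>

lemma zip_map_right_mem: "p \<in> set (zip xs (map f xs)) \<longleftrightarrow> fst p \<in> set xs \<and> snd p = f (fst p)"
  by (cases p) (auto simp: set_zip in_set_conv_nth)

text \<open>If \<open>T\<close> consists of the images of \<open>S\<close> under the subsuming
  substitution, the bindings are part of the graph of this substitution. They are therefore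
  functional and send every covered literal to its image.\<close>

lemma subsumption_test_complete:
  assumes S: "S \<in> set (List.n_lists k (lgg Ps))" and Ps: "Ps \<noteq> []"
    and sub: "realize ` set (filter (covers S) (lgg Ps)) \<turnstile> set D"
  shows "subsumption_test k S (filter (covers S) (lgg Ps)) D"
proof -
  obtain \<theta> where \<theta>: "subst_literal \<theta> (realize K) \<in> set D" if "K \<in> set (lgg Ps)" "covers S K" for K
    using sub by (auto simp: subsumes_def)
  define T where "T = map (subst_literal \<theta> \<circ> realize) S"
  \<comment> \<open>Each literal of \<open>S\<close> is covered by \<open>S\<close>, so it belongs
    to the clause and its image lies in \<open>D\<close>.\<close>
  have S': "length S = k" "set S \<subseteq> set (lgg Ps)" "\<forall>M\<in>set S. covers S M"
    using S by (auto simp: set_n_lists covers_def)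
  have T: "T \<in> set (List.n_lists k D)"
    using S' \<theta> by (auto simp: T_def set_n_lists)
  have "zip S T = map (\<lambda>M. (M, subst_literal \<theta> (realize M))) S"
    by (simp add: T_def zip_map2 zip_same_conv_map)
  then have A: "p \<in> set (bindings S T) \<longleftrightarrow>
      (\<exists>M\<in>set S. fst p \<in> set (snd M) \<and> snd p = subst_trm \<theta> (column_term (fst p)))" for p
    by (auto simp: bindings_def zip_map_right_mem realize_def)
  have "\<exists>N\<in>set D. maps_to (bindings S T) K N" if K: "K \<in> set (lgg Ps)" "covers S K" for K
  proof (rule bexI[OF _ \<theta>[OF K]])
    have "if constant_column (fst p) then snd p \<in> set (fst p) else p \<in> set (bindings S T)"
      if "fst p \<in> set (snd K)" "snd p = subst_trm \<theta> (column_term (fst p))" for p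
    proof (cases "constant_column (fst p)")
      case True
      have "fst p \<noteq> []" using length_column[OF K(1) that(1)] Ps by auto
      then have "hd (fst p) \<in> set (fst p)" by simp
      moreover from this have "is_constant (hd (fst p))"
        using constant_column_hd(2)[OF True] by blast
      ultimately show ?thesis
        using True that(2) by (auto simp: column_term_def elim!: is_constantE)
    next
      case False
      then show ?thesis using K(2) that by (auto simp: A covers_def)
    qed
    moreover have "arguments (subst_literal \<theta> (realize K)) =
        map (\<lambda>c. subst_trm \<theta> (column_term c)) (snd K)"
      by (simp add: realize_def)
    ultimately show "maps_to (bindings S T) K (subst_literal \<theta> (realize K))"
      unfolding maps_to_def using signed_relation_realize[OF K(1)]
      by (metis signed_relation_subst_literal zip_map_right_mem)
  qed
  moreover have "functional (bindings S T)"
    by (auto simp: functional_def A)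
  ultimately show ?thesis
    using T by (auto simp: subsumption_test_def)
qed

text \<open>The covered literals, realized, form the hypothesis, and those of \<open>S\<close> are
  its guard. It subsumes the positive examples as a part of the generalization, and completeness of
  the subsumption test excludes the negative ones.\<close>

lemma ilp_consistent_if_consistency_test:
  assumes S: "S \<in> set (List.n_lists k (lgg Ps))" and Ps: "Ps \<noteq> []"
    and ne: "filter (covers S) (lgg Ps) \<noteq> []"
    and Ns: "\<forall>D\<in>set Ns. \<not> subsumption_test k S (filter (covers S) (lgg Ps)) D"
  shows "ilp_consistent k (clauses Ps) (clauses Ns)"
proof -
  define Ks where "Ks = set (filter (covers S) (lgg Ps))"
  let ?H = "realize ` Ks"
  have Ks: "Ks \<subseteq> set (lgg Ps)" by (auto simp: Ks_def)
  have S': "length S = k" "set S \<subseteq> Ks"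
    using S by (auto simp: set_n_lists covers_def Ks_def)
  have nonempty: "c \<noteq> []" if "K \<in> Ks" "c \<in> set (snd K)" for K c
    using length_column[of K Ps c] that Ks Ps by auto
  have vars: "vars_literal (realize K) = column_name ` {c \<in> set (snd K). \<not> constant_column c}"
    if "K \<in> Ks" for K
    using nonempty[OF that] by (auto simp: vars_literal_def realize_def vars_column_term)
  have "function_free ?H"
  proof -
    have "function_free_trm (column_term c)" if "K \<in> Ks" "c \<in> set (snd K)" for K c
      using nonempty[OF that] constant_column_hd(2)[of c "hd c"]
      by (auto simp: column_term_def elim!: is_constantE)
    then show ?thesis by (auto simp: function_free_def realize_def)
  qed
  moreover have "guarded k ?H"
  proof -
    have "vars_literal (realize K) \<subseteq> vars_clause (realize ` set S)" if K: "K \<in> Ks" for K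
    proof
      fix x assume "x \<in> vars_literal (realize K)"
      then obtain c where c: "c \<in> set (snd K)" "\<not> constant_column c" "x = column_name c"
        using vars[OF K] by blast
      moreover from K have "covers S K" by (simp add: Ks_def)
      ultimately obtain M where "M \<in> set S" "c \<in> set (snd M)"
        by (auto simp: covers_def)
      with c S' show "x \<in> vars_clause (realize ` set S)"
        using vars[of M] by (auto simp: vars_clause_def)
    qed
    then have "vars_clause ?H \<subseteq> vars_clause (realize ` set S)"
      by (auto simp: vars_clause_def)
    moreover have "card (realize ` set S) \<le> k"
      using card_image_le[of "set S" realize] card_length[of S] S' by simp
    ultimately show ?thesis
      unfolding guarded_def using S' by (intro exI[of _ "realize ` set S"]) auto
  qed
  moreover have "?H \<turnstile> C" if "C \<in> clauses Ps" for C
    using that subsumes_realize[OF Ks] by (auto simp: clauses_def)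
  moreover have "\<not> ?H \<turnstile> C" if "C \<in> clauses Ns" for C
    using that Ns subsumption_test_complete[OF S Ps] by (auto simp: clauses_def Ks_def)
  moreover have "consistent {?H}"
    using ne by (simp only: consistent_singleton_iff Ks_def image_is_empty set_empty not_False_eq_True)
  moreover have "finite ?H" by (simp add: Ks_def)
  ultimately show ?thesis
    unfolding ilp_consistent_def by blast
qed

text \<open>A hypothesis \<open>H\<close> is sent into the generalization by \<open>gen\<close>, and
  the image of its guard serves as \<open>S\<close>. If the subsumption test accepted a negative
  example, composing \<open>gen\<close> with the matching found would make \<open>H\<close> subsume
  it.\<close>

lemma consistency_test_if_ilp_consistent:
  assumes Ps: "Ps \<noteq> []" and straight: "\<forall>C\<in>clauses Ps. straight C"
    and ilp: "ilp_consistent k (clauses Ps) (clauses Ns)"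
  shows "consistency_test k Ps Ns"
proof -
  obtain H where H: "finite H" "function_free H" "guarded k H"
    and sub: "\<forall>C\<in>set Ps. H \<turnstile> set C" and not_sub: "\<forall>D\<in>set Ns. \<not> H \<turnstile> set D"
    and ne: "H \<noteq> {}"
    using ilp by (auto simp: ilp_consistent_def consistent_singleton_iff clauses_def)
  have ff: "function_free_trm t" if "L \<in> H" "t \<in> set (arguments L)" for L t
    using H(2) that unfolding function_free_def by blast
  obtain \<theta> where \<theta>: "\<And>C L. C \<in> set Ps \<Longrightarrow> L \<in> H \<Longrightarrow> subst_literal (\<theta> C) L \<in> set C"
    using sub unfolding subsumes_def by (metis image_subset_iff)
  \<comment> \<open>The instances of \<open>t\<close> under the substitutions chosen for the
    examples form the column of every position where \<open>t\<close> stands.\<close>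
  define col where "col t = map (\<lambda>C. subst_trm (\<theta> C) t) Ps" for t
  define gen where "gen L = (subst_literal (\<theta> (hd Ps)) L, map col (arguments L))" for L
  have gen: "gen L \<in> set (lgg Ps)" if L: "L \<in> H" for L
  proof -
    let ?L = "subst_literal (\<theta> (hd Ps)) L"
    \<comment> \<open>Straightness forces the counterpart to be the instance of \<open>L\<close>
      itself.\<close>
    have cp: "counterpart C ?L = subst_literal (\<theta> C) L" if "C \<in> set Ps" for C
      using that straight \<theta>[OF that L] by (intro counterpart_eq) (auto simp: clauses_def)
    have "columns Ps ?L = map (\<lambda>j. map (\<lambda>C. arguments (counterpart C ?L) ! j) Ps)
        [0..<length (arguments ?L)]"
      by (rule columns_eq) (simp add: cp)
    also have "\<dots> = map (\<lambda>j. col (arguments L ! j)) [0..<length (arguments L)]"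
      by (auto simp: cp col_def)
    also have "\<dots> = map col (arguments L)"
      by (intro nth_equalityI) simp_all
    finally have "gen L = (?L, columns Ps ?L)"
      by (simp add: gen_def)
    moreover have "?L \<in> set (case Ps of [] \<Rightarrow> [] | C # Cs \<Rightarrow> C)"
      using Ps \<theta>[OF _ L, of "hd Ps"] by (cases Ps) simp_all
    moreover have "\<forall>C\<in>set Ps. \<exists>N\<in>set C. signed_relation N = signed_relation ?L"
      using \<theta>[OF _ L] signed_relation_subst_literal by metis
    ultimately show ?thesis
      by (simp add: lgg_def)
  qed
  obtain G where G: "G \<subseteq> H" "finite G" "card G \<le> k" "vars_clause H \<subseteq> vars_clause G"
    using H(3) by (auto simp: guarded_def)
  \<comment> \<open>The test ranges over lists of exactly \<open>k\<close> literals while the guard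
    may be smaller, so the list is filled up with copies of one literal of \<open>H\<close>.\<close>
  obtain S where S: "length S = k" "gen ` G \<subseteq> set S" "set S \<subseteq> gen ` H"
  proof -
    obtain M where M: "M \<in> H" using ne by blast
    obtain xs where xs: "set xs = G" "distinct xs"
      using finite_distinct_list[OF G(2)] by blast
    then have "length xs \<le> k" using G(3) distinct_card[of xs] by simp
    moreover have "(k > length xs \<and> set (replicate (k - length xs) M) = {M}) \<or>
        set (replicate (k - length xs) M) = {}"
      by (simp add: set_replicate_conv_if)
    ultimately show ?thesis
      using xs M G(1)
      by (intro that[of "map gen (xs @ replicate (k - length xs) M)"]) auto
  qed
  have covers: "covers S (gen L)" if L: "L \<in> H" for L
    unfolding covers_def
  proof
    fix c assume "c \<in> set (snd (gen L))"
    then obtain t where t: "t \<in> set (arguments L)" "c = col t"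
      by (auto simp: gen_def)
    show "constant_column c \<or> (\<exists>M\<in>set S. c \<in> set (snd M))"
    proof (cases t)
      case (Var x)
      then have "x \<in> vars_clause H"
        using L t by (auto simp: vars_clause_def vars_literal_def intro!: bexI[of _ L] bexI[of _ t])
      then have "x \<in> vars_clause G" using G(4) by blast
      then obtain M u where M: "M \<in> G" "u \<in> set (arguments M)" "x \<in> vars_trm u"
        by (auto simp: vars_clause_def vars_literal_def)
      then have "function_free_trm u"
        using ff G(1) by blast
      \<comment> \<open>In a function-free literal a variable occurs only as an argument, so the
        guard literal \<open>M\<close> contributes the whole column of \<open>x\<close>.\<close>
      with M(3) have "u = Var x" by (cases u) auto
      then have "c \<in> set (snd (gen M))"
        using M t Var by (auto simp: gen_def)
      then show ?thesis using S(2) M(1) by blast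
    next
      case (Fun f ts)
      then have "ts = []" using ff[OF L t(1)] by simp
      then show ?thesis using t Fun by (auto simp: constant_column_def col_def)
    qed
  qed
  let ?K = "filter (covers S) (lgg Ps)"
  have "S \<in> set (List.n_lists k (lgg Ps))"
    using S gen by (auto simp: set_n_lists)
  moreover have "?K \<noteq> []"
    using ne gen covers by (auto simp: filter_empty_conv)
  moreover have "\<not> subsumption_test k S ?K D" if D: "D \<in> set Ns" for D
  proof
    assume "subsumption_test k S ?K D"
    then obtain A where A: "functional A" "\<And>K. K \<in> set (lgg Ps) \<Longrightarrow> covers S K \<Longrightarrow> \<exists>N\<in>set D. maps_to A K N"
      by (auto simp: subsumption_test_def)
    \<comment> \<open>A variable of \<open>H\<close> may be specialized to a constant in the
      generalization and then takes this constant as its value. Otherwise its value is the one bound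
      to its column in \<open>A\<close>, unique by functionality.\<close>
    define \<sigma> where "\<sigma> x = (if constant_column (col (Var x)) then hd (col (Var x))
      else SOME t. (col (Var x), t) \<in> set A)" for x
    have "subst_literal \<sigma> L \<in> set D" if L: "L \<in> H" for L
    proof -
      obtain N where N: "N \<in> set D" "maps_to A (gen L) N"
        using A(2)[OF gen[OF L] covers[OF L]] by blast
      have sig: "signed_relation L = signed_relation N"
        using N(2) by (simp add: maps_to_def gen_def)
      then have len: "length (arguments L) = length (arguments N)"
        by (simp add: signed_relation_def)
      have "subst_trm \<sigma> (arguments L ! j) = arguments N ! j" if j: "j < length (arguments L)" for j
      proof -
        let ?t = "arguments L ! j" and ?u = "arguments N ! j"
        have "(col ?t, ?u) \<in> set (zip (map col (arguments L)) (arguments N))"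
          using j len by (auto simp: set_zip intro!: exI[of _ j])
        then have u: "if constant_column (col ?t) then ?u \<in> set (col ?t) else (col ?t, ?u) \<in> set A"
          using N(2) by (auto simp: maps_to_def gen_def dest!: bspec)
        show ?thesis
        proof (cases ?t)
          case (Var x)
          show ?thesis
          proof (cases "constant_column (col ?t)")
            case True
            then show ?thesis
              using u Var constant_column_hd(1)[of "col ?t" ?u] by (simp add: \<sigma>_def)
          next
            case False
            then have xu: "(col (Var x), ?u) \<in> set A" using u Var by simp
            moreover have "t = ?u" if "(col (Var x), t) \<in> set A" for t
              using A(1) xu that unfolding functional_def by (metis fst_conv snd_conv)
            ultimately have "(SOME t. (col (Var x), t) \<in> set A) = ?u"
              by (rule some_equality)
            then show ?thesis
              using False Var by (simp add: \<sigma>_def)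
          qed
        next
          case (Fun f ts)
          then have "ts = []" using ff[OF L nth_mem[OF j]] by simp
          with Fun have "constant_column (col ?t)" "set (col ?t) \<subseteq> {Fun f []}"
            by (auto simp: constant_column_def col_def)
          with u Fun \<open>ts = []\<close> show ?thesis by auto
        qed
      qed
      then have "subst_literal \<sigma> L = N"
        using sig len by (intro literal_eqI) (auto intro!: nth_equalityI)
      with N(1) show ?thesis by simp
    qed
    then have "H \<turnstile> set D" by (auto simp: subsumes_def)
    with not_sub D show False by blast
  qed
  ultimately show ?thesis
    unfolding consistency_test_def by blast
qed

lemma ilp_consistent_no_positive: "ilp_consistent k {} (clauses Ns)"
proof -
  let ?used = "relation ` \<Union> (clauses Ns)"
  have "finite ?used" by (auto simp: clauses_def)
  then obtain r where r: "r \<notin> ?used"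
    using ex_new_if_finite[OF infinite_UNIV_listI] by blast
  let ?H = "{Lit True r []}"
  have "vars_clause ?H = {}"
    by (simp add: vars_clause_def vars_literal_def)
  \<comment> \<open>No variable occurs, so the empty guard works even for
    \<open>k = 0\<close>.\<close>
  then have "guarded k ?H"
    unfolding guarded_def by (intro exI[of _ "{}"]) simp
  moreover have "function_free ?H" "consistent {?H}"
    by (simp_all add: function_free_def consistent_singleton_iff)
  moreover have "\<not> ?H \<turnstile> C" if "C \<in> clauses Ns" for C
  proof
    assume "?H \<turnstile> C"
    then have "Lit True r [] \<in> C"
      by (simp add: subsumes_def subst_literal_def)
    with that have "relation (Lit True r []) \<in> ?used"
      by blast
    with r show False by simp
  qed
  ultimately show ?thesis
    unfolding ilp_consistent_def by (intro exI[of _ ?H]) simp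
qed

lemma consistency_test_correct:
  assumes "\<forall>C\<in>clauses Ps. straight C"
  shows "consistency_test k Ps Ns \<longleftrightarrow> ilp_consistent k (clauses Ps) (clauses Ns)"
proof (cases "Ps = []")
  case True
  then show ?thesis
    using ilp_consistent_no_positive by (simp add: consistency_test_def clauses_def[of "[]"])
next
  case False
  then show ?thesis
    using ilp_consistent_if_consistency_test[OF _ False]
      consistency_test_if_ilp_consistent[OF False assms]
    by (auto simp: consistency_test_def)
qed

theorem theorem12:
  fixes k :: nat
  shows "decidable_in_polynomial_time ilp_instances enc_instance
    (\<lambda>(Ps, Ns). ilp_consistent k (clauses Ps) (clauses Ns))"
proof -
  have "decidable_in_polynomial_time ilp_instances enc_instance
      (\<lambda>p. consistency_test k (fst p) (snd p))"
    unfolding enc_instance_eq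
    by (intro decidable_in_polynomial_time_if_poly_time poly_time_consistency_test)
  moreover have "consistency_test k (fst i) (snd i) =
      (case i of (Ps, Ns) \<Rightarrow> ilp_consistent k (clauses Ps) (clauses Ns))" if "i \<in> ilp_instances" for i
    using that consistency_test_correct by (auto simp: ilp_instances_def)
  ultimately show ?thesis
    unfolding decidable_in_polynomial_time_def by metis
qed

end
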